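(* Let $V$ be a (possibly infinite dimensional) Banach space whose tensor powers are equipped with reasonable tensor algebra norms, and let $m\geqslant1$ be an integer. Then for every rough path of the form ${\bf X}_t=\exp(tl)$, $0\leqslant t\leqslant1$, with $l$ an arbitrary element of $T^{(m)}(V)$ with $\pi_0(l)=0$, $$L_m({\bf X})\leqslant\|\pi_m(l)\|.$$
   Context: Banach spaces are over $\mathbb{F}=\mathbb{R}$ or $\mathbb{C}$. A sequence of norms on the algebraic tensor powers $V^{\otimes_a n}$ ($n\geqslant1$) is called reasonable tensor algebra norms if: (i) for $n=1$ it is the norm of $V$; (ii) $\|\xi\otimes\eta\|\leqslant\|\xi\|\,\|\eta\|$ for $\xi\in V^{\otimes_a m},\eta\in V^{\otimes_a n}$; (iii) $\|\phi\otimes\psi\|\leqslant\|\phi\|\,\|\psi\|$ for $\phi\in(V^{\otimes_a m})^*,\psi\in(V^{\otimes_a n})^*$ with the induced dual norms; (iv) the norms are invariant under permutation of tensor factors. $V^{\otimes n}$ denotes the completion of $V^{\otimes_a n}$. $T((V))=\prod_{n\geqslant0}V^{\otimes n}$ ($V^{\otimes0}=\mathbb{F}$), $T^{(n)}(V)=\oplus_{k=0}^nV^{\otimes k}$ (products truncated at degree $n$), $\pi_n$ is the projection onto $V^{\otimes n}$, and $\exp(\xi)=\sum_{k\geqslant0}\xi^{\otimes k}/k!$; in ${\bf X}_t=\exp(tl)$ the exponential is taken in $T^{(m)}(V)$. For $p\geqslant1$, a $p$-rough path on $[0,T]$ is a continuous map ${\bf X}=(1,X^1,\dots,X^{\lfloor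 p\rfloor}):\{0\leqslant s\leqslant t\leqslant T\}\to T^{(\lfloor p\rfloor)}(V)$ with ${\bf X}_{s,u}={\bf X}_{s,t}\otimes{\bf X}_{t,u}$ and finite total $p$-variation $\sum_{k=1}^{\lfloor p\rfloor}\sup_{\mathcal{P}}\big(\sum_{t_i\in\mathcal{P}}\|X^k_{t_{i-1},t_i}\|^{p/k}\big)^{k/p}<\infty$; it is identified with the path ${\bf X}_t={\bf X}_{0,t}$ via ${\bf X}_{s,t}={\bf X}_s^{-1}\otimes{\bf X}_t$. By Lyons' extension theorem it extends uniquely to a multiplicative functional $\mathbb{X}_{s,t}=(1,X^1_{s,t},X^2_{s,t},\dots)\in T((V))$ all of whose truncations have finite total $p$-variation (same formula with $k$ up to the truncation degree); the signature is $\mathbb{X}_{0,T}$. Here ${\bf X}_t=\exp(tl)$ is regarded as a rough path with roughness $p=m$ and $T=1$; its signature is $\exp(l)\in T((V))$. $L_p({\bf X})\triangleq\limsup_{n\to\infty}\big((n/p)!\,\|X^n_{0,T}\|\big)^{p/n}$, where $x!=\Gamma(x+1)$. *)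

theory Defs
  imports
    "HOL-Analysis.Analysis"
    "HOL-Library.Poly_Mapping"
    "HOL-Library.Extended_Nonnegative_Real"
    "HOL-Combinatorics.Permutations"
begin

text \<open>
  The scalar field is a type \<open>'f::real_normed_field\<close>; by the Gelfand--Mazur theorem such a field is
  the reals or the complex numbers. The topology and norm of a Banach space come from the
  class \<open>banach\<close>, and the \<open>'f\<close>-scalar multiplication \<open>sc\<close> is a parameter compatible with them.
\<close>

definition banach_over :: "('f::real_normed_field \<Rightarrow> 'v::banach \<Rightarrow> 'v) \<Rightarrow> bool" where
  "banach_over sc \<longleftrightarrow> vector_space sc \<and>
     (\<forall>r x. sc (of_real r) x = r *\<^sub>R x) \<and>
     (\<forall>a x. norm (sc a x) = norm a * norm x)"


subsection \<open>Algebraic tensor powers\<close>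

text \<open>
  The \<open>n\<close>-th algebraic tensor power of \<open>V\<close> is \<open>free_tensors n / tensor_rel sc n\<close>: the free vector
  space on words \<open>[v\<^sub>1, \<dots>, v\<^sub>n]\<close> (standing for elementary tensors) modulo the multilinearity relations.
  Elements are handled through representatives.
\<close>

definition fscale :: "'f \<Rightarrow> ('v list \<Rightarrow>\<^sub>0 'f) \<Rightarrow> ('v list \<Rightarrow>\<^sub>0 'f::field)" where
  "fscale a x = Poly_Mapping.map ((*) a) x"

definition free_tensors :: "nat \<Rightarrow> ('v list \<Rightarrow>\<^sub>0 'f::field) set" where
  "free_tensors n = {x. \<forall>vs \<in> Poly_Mapping.keys x. length vs = n}"

abbreviation elem :: "'v list \<Rightarrow> ('v list \<Rightarrow>\<^sub>0 'f::field)" where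
  "elem vs \<equiv> Poly_Mapping.single vs 1"

definition tensor_rel :: "('f::real_normed_field \<Rightarrow> 'v::banach \<Rightarrow> 'v) \<Rightarrow> nat \<Rightarrow> ('v list \<Rightarrow>\<^sub>0 'f) set" where
  "tensor_rel sc n = module.span fscale
     ({elem (us @ [v + w] @ ws) - elem (us @ [v] @ ws) - elem (us @ [w] @ ws) | us v w ws.
         length us + 1 + length ws = n} \<union>
      {elem (us @ [sc a v] @ ws) - fscale a (elem (us @ [v] @ ws)) | us a v ws.
         length us + 1 + length ws = n})"

text \<open>The tensor product of representatives.\<close>

definition fconc :: "('v list \<Rightarrow>\<^sub>0 'f::field) \<Rightarrow> ('v list \<Rightarrow>\<^sub>0 'f) \<Rightarrow> ('v list \<Rightarrow>\<^sub>0 'f)" where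
  "fconc x y = (\<Sum>us \<in> Poly_Mapping.keys x. \<Sum>vs \<in> Poly_Mapping.keys y.
     Poly_Mapping.single (us @ vs) (Poly_Mapping.lookup x us * Poly_Mapping.lookup y vs))"

definition fpermute :: "(nat \<Rightarrow> nat) \<Rightarrow> ('v list \<Rightarrow>\<^sub>0 'f::field) \<Rightarrow> ('v list \<Rightarrow>\<^sub>0 'f)" where
  "fpermute \<sigma> x = (\<Sum>us \<in> Poly_Mapping.keys x.
     Poly_Mapping.single (permute_list \<sigma> us) (Poly_Mapping.lookup x us))"


subsection \<open>Reasonable tensor algebra norms\<close>

text \<open>
  \<open>nrm n\<close> is a seminorm on the free space whose kernel is exactly \<open>tensor_rel sc n\<close>, i.e. a norm on
  the quotient.
\<close>

definition tensor_norms ::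
    "('f::real_normed_field \<Rightarrow> 'v::banach \<Rightarrow> 'v) \<Rightarrow> (nat \<Rightarrow> ('v list \<Rightarrow>\<^sub>0 'f) \<Rightarrow> real) \<Rightarrow> bool" where
  "tensor_norms sc nrm \<longleftrightarrow> (\<forall>n.
     (\<forall>x \<in> free_tensors n. 0 \<le> nrm n x) \<and>
     (\<forall>x \<in> free_tensors n. nrm n x = 0 \<longleftrightarrow> x \<in> tensor_rel sc n) \<and>
     (\<forall>a. \<forall>x \<in> free_tensors n. nrm n (fscale a x) = norm a * nrm n x) \<and>
     (\<forall>x \<in> free_tensors n. \<forall>y \<in> free_tensors n. nrm n (x + y) \<le> nrm n x + nrm n y))"

definition dual_norm :: "(nat \<Rightarrow> ('v list \<Rightarrow>\<^sub>0 'f::real_normed_field) \<Rightarrow> real) \<Rightarrow> nat \<Rightarrow>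
    (('v list \<Rightarrow>\<^sub>0 'f) \<Rightarrow> 'f) \<Rightarrow> ennreal" where
  "dual_norm nrm n \<phi> = (SUP x \<in> {x \<in> free_tensors n. nrm n x \<le> 1}. ennreal (norm (\<phi> x)))"

text \<open>
  A linear functional on the free space with finite dual norm vanishes on the kernel of
  the seminorm, hence is the same as a bounded functional on the algebraic tensor power.
\<close>

definition tensor_dual :: "(nat \<Rightarrow> ('v list \<Rightarrow>\<^sub>0 'f::real_normed_field) \<Rightarrow> real) \<Rightarrow> nat \<Rightarrow>
    (('v list \<Rightarrow>\<^sub>0 'f) \<Rightarrow> 'f) set" where
  "tensor_dual nrm n = {\<phi>.
     (\<forall>x \<in> free_tensors n. \<forall>y \<in> free_tensors n. \<phi> (x + y) = \<phi> x + \<phi> y) \<and>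
     (\<forall>a. \<forall>x \<in> free_tensors n. \<phi> (fscale a x) = a * \<phi> x) \<and>
     dual_norm nrm n \<phi> < \<infinity>}"

text \<open>For words of length \<open>m + n\<close>, this is the linear extension of \<open>us @ vs \<mapsto> \<phi> us * \<psi> vs\<close>.\<close>

definition functional_tensor :: "nat \<Rightarrow> (('v list \<Rightarrow>\<^sub>0 'f::real_normed_field) \<Rightarrow> 'f) \<Rightarrow>
    (('v list \<Rightarrow>\<^sub>0 'f) \<Rightarrow> 'f) \<Rightarrow> ('v list \<Rightarrow>\<^sub>0 'f) \<Rightarrow> 'f" where
  "functional_tensor m \<phi> \<psi> x = (\<Sum>us \<in> Poly_Mapping.keys x.
     Poly_Mapping.lookup x us * (\<phi> (elem (take m us)) * \<psi> (elem (drop m us))))"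

text \<open>
  The tensor power of degree \<open>0\<close> is the field with its own norm; the empty word is its unit.
\<close>

definition reasonable_tensor_norms ::
    "('f::real_normed_field \<Rightarrow> 'v::banach \<Rightarrow> 'v) \<Rightarrow> (nat \<Rightarrow> ('v list \<Rightarrow>\<^sub>0 'f) \<Rightarrow> real) \<Rightarrow> bool" where
  "reasonable_tensor_norms sc nrm \<longleftrightarrow>
     tensor_norms sc nrm \<and>
     nrm 0 (elem []) = 1 \<and>
     (\<forall>v. nrm 1 (elem [v]) = norm v) \<and>
     (\<forall>m\<ge>1. \<forall>n\<ge>1. \<forall>x \<in> free_tensors m. \<forall>y \<in> free_tensors n.
        nrm (m + n) (fconc x y) \<le> nrm m x * nrm n y) \<and>
     (\<forall>m\<ge>1. \<forall>n\<ge>1. \<forall>\<phi> \<in> tensor_dual nrm m. \<forall>\<psi> \<in> tensor_dual nrm n.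
        dual_norm nrm (m + n) (functional_tensor m \<phi> \<psi>) \<le> dual_norm nrm m \<phi> * dual_norm nrm n \<psi>) \<and>
     (\<forall>n\<ge>1. \<forall>\<sigma>. \<sigma> permutes {..<n} \<longrightarrow> (\<forall>x \<in> free_tensors n. nrm n (fpermute \<sigma> x) = nrm n x))"


subsection \<open>Completed tensor powers and tensor algebras\<close>

text \<open>
  All completions live in one ambient Banach space \<open>'w\<close> (for instance a bounded product of them):
  \<open>emb n\<close> induces a linear isometry of the \<open>n\<close>-th algebraic tensor power into \<open>'w\<close>, and the
  completed tensor power is the closure of its image. No relation is imposed in \<open>'w\<close> between the
  images for different \<open>n\<close>.
\<close>

definition tensor_completion :: "(nat \<Rightarrow> ('v list \<Rightarrow>\<^sub>0 'f::real_normed_field) \<Rightarrow> real) \<Rightarrow>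
    ('f \<Rightarrow> 'w::banach \<Rightarrow> 'w) \<Rightarrow> (nat \<Rightarrow> ('v list \<Rightarrow>\<^sub>0 'f) \<Rightarrow> 'w) \<Rightarrow> bool" where
  "tensor_completion nrm sc emb \<longleftrightarrow> (\<forall>n.
     (\<forall>x \<in> free_tensors n. \<forall>y \<in> free_tensors n. emb n (x + y) = emb n x + emb n y) \<and>
     (\<forall>a. \<forall>x \<in> free_tensors n. emb n (fscale a x) = sc a (emb n x)) \<and>
     (\<forall>x \<in> free_tensors n. norm (emb n x) = nrm n x))"

definition tpow :: "(nat \<Rightarrow> ('v list \<Rightarrow>\<^sub>0 'f::field) \<Rightarrow> 'w::banach) \<Rightarrow> nat \<Rightarrow> 'w set" where
  "tpow emb n = closure (emb n ` free_tensors n)"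

text \<open>
  The continuous extension of the algebraic tensor product to the completions of degrees \<open>m\<close>, \<open>n\<close>.
\<close>

definition tens :: "(nat \<Rightarrow> ('v list \<Rightarrow>\<^sub>0 'f::field) \<Rightarrow> 'w::banach) \<Rightarrow> nat \<Rightarrow> nat \<Rightarrow> 'w \<Rightarrow> 'w \<Rightarrow> 'w" where
  "tens emb m n \<xi> \<eta> = (THE \<zeta>. \<forall>x y.
     (\<forall>k. x k \<in> free_tensors m) \<and> (\<lambda>k. emb m (x k)) \<longlonglongrightarrow> \<xi> \<and>
     (\<forall>k. y k \<in> free_tensors n) \<and> (\<lambda>k. emb n (y k)) \<longlonglongrightarrow> \<eta> \<longrightarrow>
     (\<lambda>k. emb (m + n) (fconc (x k) (y k))) \<longlonglongrightarrow> \<zeta>)"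

text \<open>
  Elements of \<open>T((V))\<close> are families \<open>g :: nat \<Rightarrow> 'w\<close>, and \<open>g n\<close> is the projection of \<open>g\<close> to degree \<open>n\<close>.
  The truncated algebra of degree \<open>N\<close> consists of the families vanishing above \<open>N\<close>.
\<close>

definition tensor_series :: "(nat \<Rightarrow> ('v list \<Rightarrow>\<^sub>0 'f::field) \<Rightarrow> 'w::banach) \<Rightarrow> (nat \<Rightarrow> 'w) set" where
  "tensor_series emb = {g. \<forall>n. g n \<in> tpow emb n}"

definition trunc :: "nat \<Rightarrow> (nat \<Rightarrow> 'w::zero) \<Rightarrow> nat \<Rightarrow> 'w" where
  "trunc N g = (\<lambda>n. if n \<le> N then g n else 0)"

definition trunc_tensors :: "(nat \<Rightarrow> ('v list \<Rightarrow>\<^sub>0 'f::field) \<Rightarrow> 'w::banach) \<Rightarrow> nat \<Rightarrow> (nat \<Rightarrow> 'w) set" where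
  "trunc_tensors emb N = {g \<in> tensor_series emb. \<forall>n>N. g n = 0}"

definition tone :: "(nat \<Rightarrow> ('v list \<Rightarrow>\<^sub>0 'f::field) \<Rightarrow> 'w::banach) \<Rightarrow> nat \<Rightarrow> 'w" where
  "tone emb = (\<lambda>n. if n = 0 then emb 0 (elem []) else 0)"

definition tmul :: "(nat \<Rightarrow> ('v list \<Rightarrow>\<^sub>0 'f::field) \<Rightarrow> 'w::banach) \<Rightarrow> (nat \<Rightarrow> 'w) \<Rightarrow> (nat \<Rightarrow> 'w) \<Rightarrow> nat \<Rightarrow> 'w" where
  "tmul emb g h = (\<lambda>n. \<Sum>i\<le>n. tens emb i (n - i) (g i) (h (n - i)))"

definition tmul_trunc :: "(nat \<Rightarrow> ('v list \<Rightarrow>\<^sub>0 'f::field) \<Rightarrow> 'w::banach) \<Rightarrow> nat \<Rightarrow>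
    (nat \<Rightarrow> 'w) \<Rightarrow> (nat \<Rightarrow> 'w) \<Rightarrow> nat \<Rightarrow> 'w" where
  "tmul_trunc emb N g h = trunc N (tmul emb g h)"

definition tinv_trunc :: "(nat \<Rightarrow> ('v list \<Rightarrow>\<^sub>0 'f::field) \<Rightarrow> 'w::banach) \<Rightarrow> nat \<Rightarrow>
    (nat \<Rightarrow> 'w) \<Rightarrow> nat \<Rightarrow> 'w" where
  "tinv_trunc emb N g = (THE h. h \<in> trunc_tensors emb N \<and>
     tmul_trunc emb N g h = tone emb \<and> tmul_trunc emb N h g = tone emb)"

text \<open>The exponential in the truncated algebra; the series is summed in each degree.\<close>

definition texp_trunc :: "(nat \<Rightarrow> ('v list \<Rightarrow>\<^sub>0 'f::field) \<Rightarrow> 'w::banach) \<Rightarrow> nat \<Rightarrow>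
    (nat \<Rightarrow> 'w) \<Rightarrow> nat \<Rightarrow> 'w" where
  "texp_trunc emb N \<xi> = (\<lambda>n. suminf (\<lambda>k. ((tmul_trunc emb N \<xi> ^^ k) (tone emb)) n /\<^sub>R fact k))"


subsection \<open>Rough paths and signatures\<close>

definition simplex2 :: "real \<Rightarrow> (real \<times> real) set" where
  "simplex2 T = {(s, t). 0 \<le> s \<and> s \<le> t \<and> t \<le> T}"

text \<open>\<open>(r, t)\<close> stands for the partition \<open>0 = t 0 < t 1 < \<dots> < t r = T\<close>.\<close>

definition partitions_of :: "real \<Rightarrow> (nat \<times> (nat \<Rightarrow> real)) set" where
  "partitions_of T = {(r, t). t 0 = 0 \<and> t r = T \<and> (\<forall>i<r. t i < t (Suc i))}"

definition total_pvar :: "real \<Rightarrow> real \<Rightarrow> nat \<Rightarrow> (real \<Rightarrow> real \<Rightarrow> nat \<Rightarrow> 'w::banach) \<Rightarrow> ennreal" where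
  "total_pvar p T N X = (\<Sum>k = 1..N. SUP (r, t) \<in> partitions_of T.
     ennreal ((\<Sum>i<r. norm (X (t i) (t (Suc i)) k) powr (p / real k)) powr (real k / p)))"

text \<open>
  Continuity into a finite (or infinite) product of the tensor powers is continuity in every degree.
\<close>

definition rough_path :: "(nat \<Rightarrow> ('v list \<Rightarrow>\<^sub>0 'f::field) \<Rightarrow> 'w::banach) \<Rightarrow> real \<Rightarrow> real \<Rightarrow>
    (real \<Rightarrow> real \<Rightarrow> nat \<Rightarrow> 'w) \<Rightarrow> bool" where
  "rough_path emb p T X \<longleftrightarrow> (let N = nat \<lfloor>p\<rfloor> in
     (\<forall>(s, t) \<in> simplex2 T. X s t \<in> trunc_tensors emb N \<and> X s t 0 = tone emb 0) \<and>
     (\<forall>k. continuous_on (simplex2 T) (\<lambda>(s, t). X s t k)) \<and>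
     (\<forall>s t u. 0 \<le> s \<and> s \<le> t \<and> t \<le> u \<and> u \<le> T \<longrightarrow> X s u = tmul_trunc emb N (X s t) (X t u)) \<and>
     total_pvar p T N X < \<infinity>)"

definition lyons_extension :: "(nat \<Rightarrow> ('v list \<Rightarrow>\<^sub>0 'f::field) \<Rightarrow> 'w::banach) \<Rightarrow> real \<Rightarrow> real \<Rightarrow>
    (real \<Rightarrow> real \<Rightarrow> nat \<Rightarrow> 'w) \<Rightarrow> (real \<Rightarrow> real \<Rightarrow> nat \<Rightarrow> 'w) \<Rightarrow> bool" where
  "lyons_extension emb p T X S \<longleftrightarrow>
     (\<forall>(s, t) \<in> simplex2 T. S s t \<in> tensor_series emb \<and> S s t 0 = tone emb 0 \<and>
        trunc (nat \<lfloor>p\<rfloor>) (S s t) = X s t) \<and>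
     (\<forall>k. continuous_on (simplex2 T) (\<lambda>(s, t). S s t k)) \<and>
     (\<forall>s t u. 0 \<le> s \<and> s \<le> t \<and> t \<le> u \<and> u \<le> T \<longrightarrow> S s u = tmul emb (S s t) (S t u)) \<and>
     (\<forall>N \<ge> nat \<lfloor>p\<rfloor>. total_pvar p T N S < \<infinity>)"

text \<open>
  The extension is unique on the simplex only, so the description is applied to its value at \<open>(0, T)\<close>.
\<close>

definition signature :: "(nat \<Rightarrow> ('v list \<Rightarrow>\<^sub>0 'f::field) \<Rightarrow> 'w::banach) \<Rightarrow> real \<Rightarrow> real \<Rightarrow>
    (real \<Rightarrow> real \<Rightarrow> nat \<Rightarrow> 'w) \<Rightarrow> nat \<Rightarrow> 'w" where
  "signature emb p T X = (THE g. \<exists>S. lyons_extension emb p T X S \<and> g = S 0 T)"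

definition sig_limsup :: "(nat \<Rightarrow> ('v list \<Rightarrow>\<^sub>0 'f::field) \<Rightarrow> 'w::banach) \<Rightarrow> real \<Rightarrow> real \<Rightarrow>
    (real \<Rightarrow> real \<Rightarrow> nat \<Rightarrow> 'w) \<Rightarrow> ereal" where
  "sig_limsup emb p T X = limsup (\<lambda>n. ereal
     ((Gamma (real n / p + 1) * norm (signature emb p T X n)) powr (p / real n)))"

text \<open>The two-parameter functional identified with a path \<open>g\<close> in the truncated algebra.\<close>

definition increments :: "(nat \<Rightarrow> ('v list \<Rightarrow>\<^sub>0 'f::field) \<Rightarrow> 'w::banach) \<Rightarrow> nat \<Rightarrow>
    (real \<Rightarrow> nat \<Rightarrow> 'w) \<Rightarrow> real \<Rightarrow> real \<Rightarrow> nat \<Rightarrow> 'w" where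
  "increments emb N g s t = tmul_trunc emb N (tinv_trunc emb N (g s)) (g t)"

end

theory Submission
  imports Defs
begin

text \<open>
  Write \<open>a\<^sub>i = \<parallel>\<pi>\<^sub>i(l)\<parallel>\<close> and \<open>P(r) = a\<^sub>1 r + \<dots> + a\<^sub>m r\<^sup>m\<close>.  The tensor product is contractive, so
  \<open>g \<mapsto> \<Sum>\<^sub>n \<parallel>g\<^sub>n\<parallel> r\<^sup>n\<close> is submultiplicative, and the degree \<open>n\<close> part of \<open>exp(l)\<close> obeys a Cauchy estimate
  \<open>\<parallel>exp(l)\<^sub>n\<parallel> r\<^sup>n \<le> exp(P(r))\<close> for every \<open>r \<ge> 0\<close> (\<open>norm_texp_weighted_le\<close>).  If \<open>A > a\<^sub>m\<close>, then
  \<open>P(r) \<le> C + A r\<^sup>m\<close> for a constant \<open>C\<close>.  For \<open>B > A\<close> put \<open>r\<^sup>m = t/B\<close>, multiply by \<open>exp(-t)\<close> and integrate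
  over \<open>t \<ge> 0\<close>: the left-hand side becomes \<open>\<parallel>exp(l)\<^sub>n\<parallel> \<Gamma>(n/m + 1) B\<^bsup>-n/m\<^esup>\<close> and the right-hand side is a
  constant independent of \<open>n\<close> (\<open>Gamma_times_coefficient_le\<close>).  Taking the power \<open>m/n\<close> removes
  the constant in the limit and leaves \<open>B\<close>, which was any number above \<open>a\<^sub>m\<close>.

  What remains is to identify the signature with \<open>exp(l)\<close>.  On the completions the tensor product is a
  bounded associative bilinear operation, so tensor series form an algebra in which
  \<open>exp(sl) exp(tl) = exp((s + t)l)\<close>, a finite computation in each degree because \<open>\<pi>\<^sub>0(l) = 0\<close>.
  Hence the increments of the path are truncations of \<open>exp((t - s)l)\<close>.  The power \<open>l\<^sup>k\<close> lives in the degrees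
  \<open>k, \<dots>, km\<close>, so the degree \<open>n\<close> part of \<open>exp((t - s)l)\<close> is at most of order \<open>(t - s)\<^bsup>n/m\<^esup>\<close>, which gives finite
  \<open>m\<close>-variation (\<open>texp_holder\<close>).  So \<open>exp((t - s)l)\<close> is an extension, and it is the only one
  (\<open>lyons_extension_unique\<close>): two extensions that agree below degree \<open>n > m\<close> differ in degree \<open>n\<close> by the
  increments of a continuous path of finite \<open>m/n\<close>-variation, and such a path is constant as \<open>m/n < 1\<close>.
\<close>

section \<open>Scalar estimates\<close>

text \<open>
  For \<open>r\<close> beyond a threshold \<open>M\<close> a lower power is at most \<open>r\<^sup>m / M\<close>, which the slack \<open>A - a\<^sub>m\<close> absorbs;
  below \<open>M\<close> it is at most \<open>M\<^sup>m\<close>, which goes into the constant.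
\<close>
lemma polynomial_le_top_term:
  fixes a :: "nat \<Rightarrow> real"
  assumes a: "\<And>k. 0 \<le> a k" and A: "a m < A"
  shows "\<exists>C. \<forall>r\<ge>0. (\<Sum>k\<le>m. a k * r ^ k) \<le> C + A * r ^ m"
proof -
  define S where "S = (\<Sum>k<m. a k)"
  define M where "M = max 1 (S / (A - a m))"
  have M: "1 \<le> M" by (simp add: M_def)
  have "S / (A - a m) \<le> M" by (simp add: M_def)
  hence SM: "S / M \<le> A - a m"
    using A M by (simp add: field_simps)
  have low: "r ^ k \<le> M ^ m + r ^ m / M" if "k < m" "0 \<le> r" for k r
  proof (cases "r \<le> M")
    case True
    have "r ^ k \<le> M ^ k" using True that by (simp add: power_mono)
    also have "\<dots> \<le> M ^ m" using M that by (simp add: power_increasing)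
    also have "\<dots> \<le> M ^ m + r ^ m / M" using that M by simp
    finally show ?thesis .
  next
    case False
    have "r ^ k * M \<le> r ^ k * r" using False that by (intro mult_left_mono) auto
    also have "\<dots> = r ^ Suc k" by simp
    also have "\<dots> \<le> r ^ m" using False M that by (intro power_increasing) auto
    finally have "r ^ k \<le> r ^ m / M" using M by (simp add: field_simps)
    thus ?thesis using M zero_le_power[of M m] by linarith
  qed
  have "(\<Sum>k\<le>m. a k * r ^ k) \<le> S * M ^ m + A * r ^ m" if r: "0 \<le> r" for r
  proof -
    have "(\<Sum>k\<le>m. a k * r ^ k) = (\<Sum>k<m. a k * r ^ k) + a m * r ^ m"
      by (simp add: lessThan_Suc_atMost[symmetric])
    also have "(\<Sum>k<m. a k * r ^ k) \<le> (\<Sum>k<m. a k * (M ^ m + r ^ m / M))"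
      using low r a by (intro sum_mono mult_left_mono) auto
    also have "\<dots> = S * M ^ m + (S / M) * r ^ m"
      unfolding S_def sum_distrib_right[symmetric] by (simp add: algebra_simps)
    also have "(S / M) * r ^ m \<le> (A - a m) * r ^ m"
      using SM r by (intro mult_right_mono) auto
    finally show ?thesis by (simp add: algebra_simps)
  qed
  thus ?thesis by blast
qed

text \<open>
  Integrating the hypothesis at \<open>r = (t/B)\<^bsup>1/m\<^esup>\<close> against \<open>exp(-t)\<close> turns \<open>r\<^sup>n\<close> into
  \<open>\<Gamma>(n/m + 1) B\<^bsup>-n/m\<^esup>\<close>.  Since \<open>B > A\<close>, the right-hand side becomes a convergent exponential integral
  whose value does not depend on \<open>n\<close>.
\<close>
lemma Gamma_times_coefficient_le:
  fixes c K A B :: real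
  assumes K: "0 \<le> K" and m: "1 \<le> m" and A: "0 \<le> A" "A < B"
    and bound: "\<And>r. 0 \<le> r \<Longrightarrow> c * r ^ n \<le> K * exp (A * r ^ m)"
  shows "Gamma (real n / real m + 1) * c \<le> K / (1 - A / B) * B powr (real n / real m)"
proof -
  define y where "y = real n / real m"
  define \<theta> where "\<theta> = A / B"
  have B: "0 < B" using A by simp
  have \<theta>: "\<theta> < 1" using A B by (simp add: \<theta>_def)
  have "y \<ge> 0" by (simp add: y_def)
  have G: "((\<lambda>t. t powr y / exp t) has_integral Gamma (y + 1)) {0..}"
    using Gamma_integral_real[of "y + 1"] \<open>y \<ge> 0\<close> by simp
  have L: "((\<lambda>t. (c * B powr (-y)) * (t powr y / exp t)) has_integral
      (c * B powr (-y)) * Gamma (y + 1)) {0..}"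
    by (rule has_integral_mult_right[OF G])
  have R: "((\<lambda>t. K * exp (-(1 - \<theta>) * t)) has_integral K * (1 / (1 - \<theta>))) {0..}"
    using has_integral_mult_right[OF has_integral_exp_minus_to_infinity[of "1 - \<theta>" 0], of K] \<theta>
    by simp
  have "(c * B powr (-y)) * (t powr y / exp t) \<le> K * exp (-(1 - \<theta>) * t)" if t: "t \<in> {0..}" for t
  proof (cases "t = 0")
    case True
    thus ?thesis using K by simp
  next
    case False
    with t have t: "t > 0" by simp
    define r where "r = (t / B) powr (1 / real m)"
    have rn: "r ^ j = (t / B) powr (real j / real m)" for j
      using t B by (simp add: r_def powr_realpow[symmetric] powr_powr)
    have "c * r ^ n \<le> K * exp (A * r ^ m)" by (rule bound) (simp add: r_def)
    also have "r ^ n = B powr (-y) * t powr y"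
      using t B by (simp add: rn y_def powr_divide powr_minus field_simps)
    also have "A * r ^ m = \<theta> * t"
      using m t B by (simp add: rn \<theta>_def)
    finally have "c * (B powr (-y) * t powr y) / exp t \<le> K * exp (\<theta> * t) / exp t"
      by (intro divide_right_mono) auto
    also have "K * exp (\<theta> * t) / exp t = K * exp (-(1 - \<theta>) * t)"
      by (simp add: exp_diff left_diff_distrib)
    finally show ?thesis by (simp add: mult.assoc)
  qed
  from has_integral_le[OF L R this]
  have "(c * B powr (-y)) * Gamma (y + 1) \<le> K * (1 / (1 - \<theta>))" .
  hence "(c * B powr (-y)) * Gamma (y + 1) * B powr y \<le> K * (1 / (1 - \<theta>)) * B powr y"
    by (intro mult_right_mono) auto
  thus ?thesis using B by (simp add: y_def \<theta>_def powr_minus field_simps)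
qed

text \<open>The constant \<open>K\<close> may depend on \<open>B\<close>, because \<open>K\<^bsup>m/n\<^esup>\<close> tends to \<open>1\<close>.\<close>
lemma limsup_powr_le:
  fixes u :: "nat \<Rightarrow> real"
  assumes m: "1 \<le> m" and b: "0 \<le> b" and u: "\<And>n. 0 \<le> u n"
    and bound: "\<And>B. b < B \<Longrightarrow> \<exists>K. \<forall>n. u n \<le> K * B powr (real n / real m)"
  shows "limsup (\<lambda>n. ereal (u n powr (real m / real n))) \<le> ereal b"
proof (rule ereal_le_epsilon2)
  fix e :: real assume "0 < e"
  define B where "B = b + e"
  have B: "b < B" "0 < B" using \<open>0 < e\<close> b by (auto simp: B_def)
  obtain K0 where K0: "\<And>n. u n \<le> K0 * B powr (real n / real m)" using bound[OF B(1)] by blast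
  define K where "K = max K0 1"
  have K: "0 < K" "K0 \<le> K" by (auto simp: K_def)
  have le: "u n powr (real m / real n) \<le> K powr (real m / real n) * B" if "n \<ge> 1" for n
  proof -
    have "u n \<le> K * B powr (real n / real m)"
      using K0[of n] K(2) by (meson mult_right_mono order_trans powr_ge_zero)
    hence "u n powr (real m / real n) \<le> (K * B powr (real n / real m)) powr (real m / real n)"
      using u by (intro powr_mono2) auto
    also have "\<dots> = K powr (real m / real n) * B"
      using K B m that by (simp add: powr_mult powr_powr)
    finally show ?thesis .
  qed
  have "(\<lambda>n. K powr (real m / real n) * B) \<longlonglongrightarrow> K powr 0 * B"
    using K by (intro tendsto_intros lim_const_over_n) auto
  hence "(\<lambda>n. ereal (K powr (real m / real n) * B)) \<longlonglongrightarrow> ereal B" using K by simp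
  hence "limsup (\<lambda>n. ereal (K powr (real m / real n) * B)) = ereal B"
    by (intro lim_imp_Limsup) auto
  moreover have "limsup (\<lambda>n. ereal (u n powr (real m / real n)))
      \<le> limsup (\<lambda>n. ereal (K powr (real m / real n) * B))"
    using le by (intro Limsup_mono eventually_sequentiallyI[of 1]) auto
  ultimately show "limsup (\<lambda>n. ereal (u n powr (real m / real n))) \<le> ereal b + ereal e"
    by (simp add: B_def)
qed

section \<open>Variation along partitions\<close>

text \<open>
  When all increments over a uniform partition are at most \<open>e\<close>, an increment \<open>d\<close> satisfies
  \<open>d \<le> e\<^bsup>1-q\<^esup> d\<^bsup>q\<^esup>\<close>, so the total length of the polygon is at most \<open>e\<^bsup>1-q\<^esup> K\<close>.  Uniform continuity makes
  \<open>e\<close> as small as desired.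
\<close>
lemma constant_if_finite_variation_below_one:
  fixes f :: "real \<Rightarrow> 'a::real_normed_vector"
  assumes cont: "continuous_on {0..1} f" and q: "0 < q" "q < 1"
    and K: "\<And>r. 1 \<le> r \<Longrightarrow>
      (\<Sum>i<r. norm (f (real (Suc i) / real r) - f (real i / real r)) powr q) \<le> K"
    and t: "t \<in> {0..1}"
  shows "f t = f 0"
proof -
  have main: "norm (f t - f 0) \<le> e + e powr (1 - q) * K" if e: "0 < e" for e
  proof -
    have "uniformly_continuous_on {0..1} f"
      using cont by (intro compact_uniformly_continuous) auto
    then obtain d where d: "0 < d"
      and unif: "\<And>x y. x \<in> {0..1} \<Longrightarrow> y \<in> {0..1} \<Longrightarrow> dist y x < d \<Longrightarrow> dist (f y) (f x) < e"
      using e unfolding uniformly_continuous_on_def by metis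
    obtain r where r: "r \<noteq> 0" "inverse (real r) < d"
      using d real_arch_inverse by blast
    \<comment> \<open>The grid point \<open>a/r\<close> just below \<open>t\<close> is reached from \<open>0\<close> by whole cells of the partition.\<close>
    define a where "a = nat \<lfloor>t * real r\<rfloor>"
    have tr: "0 \<le> t * real r" "t * real r \<le> real r"
      using t by (auto simp: mult_left_le_one_le)
    have a: "real a \<le> t * real r" "t * real r < real a + 1"
      using tr unfolding a_def by linarith+
    have ar: "a \<le> r" using a tr by linarith
    have "dist t (real a / real r) < d"
    proof -
      have "\<bar>t - real a / real r\<bar> = (t * real r - real a) / real r"
        using a r by (simp add: field_simps abs_if)
      also have "\<dots> \<le> 1 / real r" using a by (intro divide_right_mono) auto
      finally show ?thesis using r by (simp add: dist_real_def inverse_eq_divide)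
    qed
    hence 1: "norm (f t - f (real a / real r)) \<le> e"
      using unif[of "real a / real r" t] t ar r by (simp add: dist_norm)
    define D where "D i = f (real (Suc i) / real r) - f (real i / real r)" for i
    have D: "norm (D i) \<le> e powr (1 - q) * norm (D i) powr q" if i: "i < r" for i
    proof -
      have "dist (real (Suc i) / real r) (real i / real r) < d"
        using r by (simp add: dist_real_def diff_divide_distrib[symmetric] field_simps)
      hence De: "norm (D i) \<le> e"
        using unif[of "real i / real r" "real (Suc i) / real r"] i by (simp add: D_def dist_norm)
      have "norm (D i) = norm (D i) powr (1 - q) * norm (D i) powr q"
        by (simp add: powr_add[symmetric])
      also have "\<dots> \<le> e powr (1 - q) * norm (D i) powr q"
        using De q by (intro mult_right_mono powr_mono2) auto
      finally show ?thesis .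
    qed
    have "f (real a / real r) - f 0 = (\<Sum>i<a. D i)"
      unfolding D_def using sum_lessThan_telescope[of "\<lambda>i. f (real i / real r)" a] by simp
    hence "norm (f (real a / real r) - f 0) \<le> (\<Sum>i<a. norm (D i))"
      by (simp add: norm_sum)
    also have "\<dots> \<le> (\<Sum>i<r. norm (D i))" using ar by (intro sum_mono2) auto
    also have "\<dots> \<le> (\<Sum>i<r. e powr (1 - q) * norm (D i) powr q)"
      using D by (intro sum_mono) auto
    also have "\<dots> = e powr (1 - q) * (\<Sum>i<r. norm (D i) powr q)" by (simp add: sum_distrib_left)
    also have "\<dots> \<le> e powr (1 - q) * K"
      using K[of r] r by (intro mult_left_mono) (auto simp: D_def)
    finally show ?thesis
      using 1 norm_triangle_ineq[of "f t - f (real a / real r)" "f (real a / real r) - f 0"] by simp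
  qed
  have "((\<lambda>e. e + e powr (1 - q) * K) \<longlongrightarrow> 0 + 0 powr (1 - q) * K) (at_right 0)"
    using q by (intro tendsto_intros tendsto_powr') (auto simp: eventually_at_filter)
  moreover have "eventually (\<lambda>e. norm (f t - f 0) \<le> e + e powr (1 - q) * K) (at_right 0)"
    using main by (auto simp: eventually_at_filter)
  ultimately have "norm (f t - f 0) \<le> 0 + 0 powr (1 - q) * K"
    by (rule tendsto_lowerbound) simp
  thus ?thesis by simp
qed

text \<open>After division by \<open>x + y \<noteq> 0\<close> both summands lie in \<open>[0, 1]\<close>, where \<open>w \<le> w\<^bsup>q\<^esup>\<close>.\<close>
lemma powr_subadditive:
  fixes x y q :: real
  assumes x: "0 \<le> x" and y: "0 \<le> y" and q: "0 < q" "q \<le> 1"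
  shows "(x + y) powr q \<le> x powr q + y powr q"
proof (cases "x + y = 0")
  case True
  thus ?thesis using q by simp
next
  case False
  hence z: "0 < x + y" using x y by simp
  have le: "w / (x + y) \<le> w powr q / (x + y) powr q" if "0 \<le> w" "w \<le> x + y" for w
  proof -
    have "(w / (x + y)) powr 1 \<le> (w / (x + y)) powr q"
      using that q z by (intro powr_mono') auto
    thus ?thesis using that z by (simp add: powr_divide)
  qed
  have "1 = x / (x + y) + y / (x + y)" using z by (simp add: add_divide_distrib[symmetric])
  also have "\<dots> \<le> x powr q / (x + y) powr q + y powr q / (x + y) powr q"
    using x y by (intro add_mono le) auto
  also have "\<dots> = (x powr q + y powr q) / (x + y) powr q" by (simp add: add_divide_distrib)
  finally show ?thesis using z by (simp add: field_simps)
qed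

lemma partition_interval:
  assumes "(r, t) \<in> partitions_of T" "i < r"
  shows "0 \<le> t i" "t i < t (Suc i)" "t (Suc i) \<le> T"
proof -
  have P: "t 0 = 0" "t r = T" "\<And>i. i < r \<Longrightarrow> t i < t (Suc i)"
    using assms(1) by (auto simp: partitions_of_def)
  have "j \<le> r \<Longrightarrow> 0 \<le> t j" for j
  proof (induction j)
    case (Suc j)
    thus ?case using P(3)[of j] by simp
  qed (use P in simp)
  thus "0 \<le> t i" using assms by simp
  show "t i < t (Suc i)" by (rule P(3)[OF assms(2)])
  have "t j \<le> T" if "j \<le> r" for j
    using that
  proof (induction j rule: inc_induct)
    case base
    show ?case using P by simp
  next
    case (step n)
    thus ?case using P(3)[of n] by simp
  qed
  thus "t (Suc i) \<le> T" using assms by simp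
qed

text \<open>
  Raising the hypothesis to the power \<open>p/k\<close> gives a bound linear in \<open>t - s\<close>, which telescopes along a partition.
\<close>
lemma total_pvar_finite:
  assumes p: "0 < p"
    and bound: "\<And>k. 1 \<le> k \<Longrightarrow> k \<le> N \<Longrightarrow> \<exists>C\<ge>0. \<forall>s t. 0 \<le> s \<longrightarrow> s < t \<longrightarrow> t \<le> T \<longrightarrow>
      norm (X s t k) \<le> C * (t - s) powr (real k / p)"
  shows "total_pvar p T N X < \<infinity>"
  unfolding total_pvar_def infinity_ennreal_def
proof (subst ennreal_sum_less_top, simp, intro ballI)
  fix k assume "k \<in> {1..N}"
  hence k: "1 \<le> k" "k \<le> N" by auto
  then obtain C where C: "0 \<le> C" and XC: "\<And>s t. 0 \<le> s \<Longrightarrow> s < t \<Longrightarrow> t \<le> T \<Longrightarrow>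
      norm (X s t k) \<le> C * (t - s) powr (real k / p)"
    using bound by blast
  have "(\<Sum>i<r. norm (X (t i) (t (Suc i)) k) powr (p / real k)) powr (real k / p)
      \<le> (C powr (p / real k) * T) powr (real k / p)" if rt: "(r, t) \<in> partitions_of T" for r t
  proof -
    have "norm (X (t i) (t (Suc i)) k) powr (p / real k) \<le> C powr (p / real k) * (t (Suc i) - t i)"
      if i: "i < r" for i
    proof -
      note ti = partition_interval[OF rt i]
      have "norm (X (t i) (t (Suc i)) k) powr (p / real k)
          \<le> (C * (t (Suc i) - t i) powr (real k / p)) powr (p / real k)"
        using XC[OF ti] p by (intro powr_mono2) auto
      also have "\<dots> = C powr (p / real k) * (t (Suc i) - t i)"
        using C k p ti by (simp add: powr_mult powr_powr)
      finally show ?thesis .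
    qed
    hence "(\<Sum>i<r. norm (X (t i) (t (Suc i)) k) powr (p / real k))
        \<le> (\<Sum>i<r. C powr (p / real k) * (t (Suc i) - t i))"
      by (intro sum_mono) auto
    also have "\<dots> = C powr (p / real k) * T"
      using rt by (simp add: sum_distrib_left[symmetric] sum_lessThan_telescope partitions_of_def)
    finally show ?thesis
      using p by (intro powr_mono2) (auto intro: sum_nonneg)
  qed
  hence "(SUP (r, t)\<in>partitions_of T. ennreal ((\<Sum>i<r. norm (X (t i) (t (Suc i)) k) powr (p / real k))
      powr (real k / p))) \<le> ennreal ((C powr (p / real k) * T) powr (real k / p))"
    by (intro SUP_least) (auto intro: ennreal_leI)
  also have "\<dots> < top" by simp
  finally show "(SUP (r, t)\<in>partitions_of T. ennreal ((\<Sum>i<r. norm (X (t i) (t (Suc i)) k)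
      powr (p / real k)) powr (real k / p))) < top" .
qed

text \<open>The outer exponent \<open>k/p\<close> is undone, so that the sums of powers themselves are bounded.\<close>
lemma total_pvar_finiteD:
  assumes p: "0 < p" and fin: "total_pvar p T N X < \<infinity>" and k: "1 \<le> k" "k \<le> N"
  shows "\<exists>K. \<forall>r t. (r, t) \<in> partitions_of T \<longrightarrow>
    (\<Sum>i<r. norm (X (t i) (t (Suc i)) k) powr (p / real k)) \<le> K"
proof -
  let ?S = "\<lambda>r t. (\<Sum>i<r. norm (X (t i) (t (Suc i)) k) powr (p / real k))"
  let ?V = "SUP (r, t)\<in>partitions_of T. ennreal (?S r t powr (real k / p))"
  have "?V < top"
    using fin k unfolding total_pvar_def infinity_ennreal_def
    by (subst (asm) ennreal_sum_less_top) auto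
  then obtain v where v: "0 \<le> v" "?V = ennreal v" by (cases ?V) auto
  have "?S r t \<le> v powr (p / real k)" if rt: "(r, t) \<in> partitions_of T" for r t
  proof -
    have "ennreal (?S r t powr (real k / p)) \<le> ?V"
      using rt by (intro SUP_upper2[of "(r, t)"]) auto
    hence "?S r t powr (real k / p) \<le> v" using v by simp
    hence "(?S r t powr (real k / p)) powr (p / real k) \<le> v powr (p / real k)"
      using p by (intro powr_mono2) auto
    moreover have "0 \<le> ?S r t" by (intro sum_nonneg) auto
    ultimately show ?thesis using p k by (simp add: powr_powr)
  qed
  thus ?thesis by blast
qed


section \<open>Free tensors\<close>

lemma lookup_fscale: "Poly_Mapping.lookup (fscale a x) k = a * Poly_Mapping.lookup x k"
  by (simp add: fscale_def Poly_Mapping.map.rep_eq when_def)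

lemma fscale_single: "fscale a (Poly_Mapping.single k b) = Poly_Mapping.single k (a * b)"
  by (rule poly_mapping_eqI) (simp add: lookup_fscale lookup_single when_def)

lemma keys_fscale: "Poly_Mapping.keys (fscale a x) \<subseteq> Poly_Mapping.keys x"
  by (auto simp: in_keys_iff lookup_fscale)

lemma diff_eq_add_fscale: "x - y = x + fscale (-1) y"
  by (rule poly_mapping_eqI) (simp add: lookup_fscale lookup_add lookup_minus)

lemma free_tensors_0: "0 \<in> free_tensors n"
  by (simp add: free_tensors_def)

lemma free_tensors_add: "x \<in> free_tensors n \<Longrightarrow> y \<in> free_tensors n \<Longrightarrow> x + y \<in> free_tensors n"
  using keys_add[of x y] by (auto simp: free_tensors_def)

lemma free_tensors_fscale: "x \<in> free_tensors n \<Longrightarrow> fscale a x \<in> free_tensors n"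
  using keys_fscale[of a x] by (auto simp: free_tensors_def)

lemma free_tensors_diff: "x \<in> free_tensors n \<Longrightarrow> y \<in> free_tensors n \<Longrightarrow> x - y \<in> free_tensors n"
  unfolding diff_eq_add_fscale by (intro free_tensors_add free_tensors_fscale)

lemma free_tensors_sum: "(\<And>i. i \<in> I \<Longrightarrow> f i \<in> free_tensors n) \<Longrightarrow> sum f I \<in> free_tensors n"
  by (induction I rule: infinite_finite_induct) (auto intro: free_tensors_0 free_tensors_add)

lemma free_tensors_single: "length vs = n \<Longrightarrow> Poly_Mapping.single vs a \<in> free_tensors n"
  by (simp add: free_tensors_def)

lemma free_tensors_degree_0:
  assumes "x \<in> free_tensors 0"
  shows "x = Poly_Mapping.single [] (Poly_Mapping.lookup x [])"
proof (rule poly_mapping_eqI)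
  fix k
  have "Poly_Mapping.lookup x k = 0" if "k \<noteq> []"
    using assms that by (auto simp: free_tensors_def in_keys_iff)
  thus "Poly_Mapping.lookup x k = Poly_Mapping.lookup (Poly_Mapping.single [] (Poly_Mapping.lookup x [])) k"
    by (cases "k = []") (auto simp: lookup_single when_def)
qed

lemma poly_mapping_sum_single:
  assumes "finite A" "Poly_Mapping.keys x \<subseteq> A"
  shows "(\<Sum>k\<in>A. Poly_Mapping.single k (Poly_Mapping.lookup x k)) = x"
proof (rule poly_mapping_eqI)
  fix k
  have "(\<Sum>j\<in>A. Poly_Mapping.lookup x j when j = k) = Poly_Mapping.lookup x k"
    using assms by (auto simp: when_def in_keys_iff)
  thus "Poly_Mapping.lookup (\<Sum>j\<in>A. Poly_Mapping.single j (Poly_Mapping.lookup x j)) k = Poly_Mapping.lookup x k"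
    by (simp add: lookup_sum lookup_single)
qed

text \<open>
  Arbitrary finite index sets are allowed so that several tensors can be expanded over a common one;
  this is how bilinearity is obtained.
\<close>
lemma fconc_eq_sum:
  assumes A: "finite A" "Poly_Mapping.keys x \<subseteq> A" and B: "finite B" "Poly_Mapping.keys y \<subseteq> B"
  shows "fconc x y = (\<Sum>us\<in>A. \<Sum>vs\<in>B.
    Poly_Mapping.single (us @ vs) (Poly_Mapping.lookup x us * Poly_Mapping.lookup y vs))"
proof -
  have "fconc x y = (\<Sum>us\<in>Poly_Mapping.keys x. \<Sum>vs\<in>B.
    Poly_Mapping.single (us @ vs) (Poly_Mapping.lookup x us * Poly_Mapping.lookup y vs))"
    unfolding fconc_def using B
    by (intro sum.cong refl sum.mono_neutral_left) (auto simp: in_keys_iff)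
  also have "\<dots> = (\<Sum>us\<in>A. \<Sum>vs\<in>B.
    Poly_Mapping.single (us @ vs) (Poly_Mapping.lookup x us * Poly_Mapping.lookup y vs))"
    using A by (intro sum.mono_neutral_left) (auto simp: in_keys_iff)
  finally show ?thesis .
qed

lemma fconc_add_left: "fconc (x + x') y = fconc x y + fconc x' y"
proof -
  let ?A = "Poly_Mapping.keys x \<union> Poly_Mapping.keys x'"
  have "fconc z y = (\<Sum>us\<in>?A. \<Sum>vs\<in>Poly_Mapping.keys y.
      Poly_Mapping.single (us @ vs) (Poly_Mapping.lookup z us * Poly_Mapping.lookup y vs))"
    if "Poly_Mapping.keys z \<subseteq> ?A" for z
    using that by (intro fconc_eq_sum) auto
  from this[of "x + x'"] this[of x] this[of x'] show ?thesis
    using keys_add[of x x'] by (simp add: lookup_add distrib_right single_add sum.distrib)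
qed

lemma fconc_add_right: "fconc x (y + y') = fconc x y + fconc x y'"
proof -
  let ?B = "Poly_Mapping.keys y \<union> Poly_Mapping.keys y'"
  have "fconc x z = (\<Sum>us\<in>Poly_Mapping.keys x. \<Sum>vs\<in>?B.
      Poly_Mapping.single (us @ vs) (Poly_Mapping.lookup x us * Poly_Mapping.lookup z vs))"
    if "Poly_Mapping.keys z \<subseteq> ?B" for z
    using that by (intro fconc_eq_sum) auto
  from this[of "y + y'"] this[of y] this[of y'] show ?thesis
    using keys_add[of y y'] by (simp add: lookup_add distrib_left single_add sum.distrib)
qed

lemma fconc_zero: "fconc 0 y = 0" "fconc x 0 = 0"
  by (simp_all add: fconc_def)

lemma fscale_add: "fscale a (x + y) = fscale a x + fscale a y"
  by (rule poly_mapping_eqI) (simp add: lookup_fscale lookup_add distrib_left)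

lemma fscale_zero: "fscale a 0 = 0"
  by (rule poly_mapping_eqI) (simp add: lookup_fscale)

lemma fscale_sum: "fscale a (sum f I) = (\<Sum>i\<in>I. fscale a (f i))"
  by (induction I rule: infinite_finite_induct) (auto simp: fscale_add fscale_zero)

lemma fconc_fscale_left: "fconc (fscale a x) y = fscale a (fconc x y)"
  by (subst fconc_eq_sum[of "Poly_Mapping.keys x" _ "Poly_Mapping.keys y"])
     (auto simp: keys_fscale fconc_def fscale_sum fscale_single lookup_fscale mult.assoc)

lemma fconc_fscale_right: "fconc x (fscale a y) = fscale a (fconc x y)"
  by (subst fconc_eq_sum[of "Poly_Mapping.keys x" _ "Poly_Mapping.keys y"])
     (auto simp: keys_fscale fconc_def fscale_sum fscale_single lookup_fscale mult.left_commute)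

lemma fconc_diff_left: "fconc (x - x') y = fconc x y - fconc x' y"
  by (simp add: diff_eq_add_fscale fconc_add_left fconc_fscale_left)

lemma fconc_diff_right: "fconc x (y - y') = fconc x y - fconc x y'"
  by (simp add: diff_eq_add_fscale fconc_add_right fconc_fscale_right)

lemma fconc_sum_left: "fconc (sum f I) y = (\<Sum>i\<in>I. fconc (f i) y)"
  by (induction I rule: infinite_finite_induct) (auto simp: fconc_zero fconc_add_left)

lemma fconc_sum_right: "fconc x (sum f I) = (\<Sum>i\<in>I. fconc x (f i))"
  by (induction I rule: infinite_finite_induct) (auto simp: fconc_zero fconc_add_right)

lemma fconc_single_left:
  "fconc (Poly_Mapping.single us a) y =
    (\<Sum>vs\<in>Poly_Mapping.keys y. Poly_Mapping.single (us @ vs) (a * Poly_Mapping.lookup y vs))"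
  by (subst fconc_eq_sum[of "{us}" _ "Poly_Mapping.keys y"]) auto

lemma fconc_single_right:
  "fconc x (Poly_Mapping.single vs b) =
    (\<Sum>us\<in>Poly_Mapping.keys x. Poly_Mapping.single (us @ vs) (Poly_Mapping.lookup x us * b))"
  by (subst fconc_eq_sum[of "Poly_Mapping.keys x" _ "{vs}"]) auto

lemma fconc_assoc: "fconc (fconc x y) z = fconc x (fconc y z)"
proof -
  let ?l = Poly_Mapping.lookup and ?K = Poly_Mapping.keys and ?s = Poly_Mapping.single
  have "fconc (fconc x y) z =
      (\<Sum>us\<in>?K x. \<Sum>vs\<in>?K y. \<Sum>ws\<in>?K z. ?s (us @ vs @ ws) (?l x us * ?l y vs * ?l z ws))"
    by (simp add: fconc_def[of x y] fconc_sum_left fconc_single_left)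
  also have "\<dots> = (\<Sum>vs\<in>?K y. \<Sum>ws\<in>?K z. fconc x (?s (vs @ ws) (?l y vs * ?l z ws)))"
    by (subst sum.swap, rule sum.cong[OF refl], subst sum.swap)
       (simp add: fconc_single_right mult.assoc)
  also have "\<dots> = fconc x (fconc y z)"
    by (simp add: fconc_def[of y z] fconc_sum_right)
  finally show ?thesis .
qed

lemma fconc_unit_left: "fconc (Poly_Mapping.single [] a) y = fscale a y"
proof -
  have "fconc (Poly_Mapping.single [] a) y =
      fscale a (\<Sum>vs\<in>Poly_Mapping.keys y. Poly_Mapping.single vs (Poly_Mapping.lookup y vs))"
    by (simp add: fconc_single_left fscale_sum fscale_single)
  thus ?thesis by (simp add: poly_mapping_sum_single)
qed

lemma fconc_unit_right: "fconc x (Poly_Mapping.single [] b) = fscale b x"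
proof -
  have "fconc x (Poly_Mapping.single [] b) =
      fscale b (\<Sum>us\<in>Poly_Mapping.keys x. Poly_Mapping.single us (Poly_Mapping.lookup x us))"
    by (simp add: fconc_single_right fscale_sum fscale_single mult.commute)
  thus ?thesis by (simp add: poly_mapping_sum_single)
qed

lemma fscale_one: "fscale 1 x = x"
  by (rule poly_mapping_eqI) (simp add: lookup_fscale)

lemma free_tensors_fconc:
  "x \<in> free_tensors m \<Longrightarrow> y \<in> free_tensors n \<Longrightarrow> fconc x y \<in> free_tensors (m + n)"
  unfolding fconc_def
  by (intro free_tensors_sum free_tensors_single) (auto simp: free_tensors_def)


section \<open>The tensor product of the completions\<close>

locale tensor_algebra =
  fixes scV :: "'f::real_normed_field \<Rightarrow> 'v::banach \<Rightarrow> 'v"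
    and scW :: "'f \<Rightarrow> 'w::banach \<Rightarrow> 'w"
    and nrm :: "nat \<Rightarrow> ('v list \<Rightarrow>\<^sub>0 'f) \<Rightarrow> real"
    and emb :: "nat \<Rightarrow> ('v list \<Rightarrow>\<^sub>0 'f) \<Rightarrow> 'w"
  assumes scW: "banach_over scW"
    and nrm: "reasonable_tensor_norms scV nrm"
    and emb: "tensor_completion nrm scW emb"
begin

lemma emb_add: "x \<in> free_tensors n \<Longrightarrow> y \<in> free_tensors n \<Longrightarrow> emb n (x + y) = emb n x + emb n y"
  using emb by (auto simp: tensor_completion_def)

lemma emb_fscale: "x \<in> free_tensors n \<Longrightarrow> emb n (fscale a x) = scW a (emb n x)"
  using emb by (auto simp: tensor_completion_def)

lemma emb_scaleR: "x \<in> free_tensors n \<Longrightarrow> emb n (fscale (of_real r) x) = r *\<^sub>R emb n x"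
  using scW by (simp add: emb_fscale banach_over_def)

lemma norm_emb: "x \<in> free_tensors n \<Longrightarrow> norm (emb n x) = nrm n x"
  using emb by (auto simp: tensor_completion_def)

lemma emb_diff: "x \<in> free_tensors n \<Longrightarrow> y \<in> free_tensors n \<Longrightarrow> emb n (x - y) = emb n x - emb n y"
  using emb_scaleR[of y n "-1"]
  by (simp add: diff_eq_add_fscale emb_add free_tensors_fscale)

lemma emb_zero: "emb n 0 = 0"
  using emb_add[of 0 n 0] by (simp add: free_tensors_0)

lemma nrm_fscale: "x \<in> free_tensors n \<Longrightarrow> nrm n (fscale a x) = norm a * nrm n x"
  using nrm by (auto simp: reasonable_tensor_norms_def tensor_norms_def)

lemma nrm_degree_0: "nrm 0 (Poly_Mapping.single [] a) = norm a"
proof -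
  have "Poly_Mapping.single [] a = fscale a (elem [] :: 'v list \<Rightarrow>\<^sub>0 'f)"
    by (simp add: fscale_single)
  thus ?thesis
    using nrm nrm_fscale[of "elem []" 0 a]
    by (simp add: free_tensors_single reasonable_tensor_norms_def)
qed

text \<open>
  Reasonableness gives this for positive degrees.  A tensor of degree \<open>0\<close> is a multiple of the empty word,
  and multiplication by it is scalar multiplication.
\<close>
lemma nrm_fconc_le:
  assumes x: "x \<in> free_tensors m" and y: "y \<in> free_tensors n"
  shows "nrm (m + n) (fconc x y) \<le> nrm m x * nrm n y"
proof -
  consider "m = 0" | "n = 0" | "1 \<le> m" "1 \<le> n" by linarith
  thus ?thesis
  proof cases
    case 1
    then obtain a where "x = Poly_Mapping.single [] a"
      using x free_tensors_degree_0 by metis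
    thus ?thesis using 1 y by (simp add: fconc_unit_left nrm_fscale nrm_degree_0)
  next
    case 2
    then obtain a where "y = Poly_Mapping.single [] a"
      using y free_tensors_degree_0 by metis
    thus ?thesis using 2 x by (simp add: fconc_unit_right nrm_fscale nrm_degree_0)
  next
    case 3
    thus ?thesis using nrm x y by (auto simp: reasonable_tensor_norms_def)
  qed
qed

lemma norm_emb_fconc_le:
  "x \<in> free_tensors m \<Longrightarrow> y \<in> free_tensors n \<Longrightarrow>
    norm (emb (m + n) (fconc x y)) \<le> norm (emb m x) * norm (emb n y)"
  by (simp add: norm_emb free_tensors_fconc nrm_fconc_le)

text \<open>
  The estimate \<open>xy - x'y' = (x - x')y + x'(y - y')\<close>, from which the tensor product extends continuously
  to the completions.
\<close>
lemma norm_emb_fconc_diff_le: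
  assumes "x \<in> free_tensors m" "x' \<in> free_tensors m" "y \<in> free_tensors n" "y' \<in> free_tensors n"
  shows "norm (emb (m + n) (fconc x y) - emb (m + n) (fconc x' y')) \<le>
    norm (emb m x - emb m x') * norm (emb n y) + norm (emb m x') * norm (emb n y - emb n y')"
proof -
  have "fconc x y - fconc x' y' = fconc (x - x') y + fconc x' (y - y')"
    by (simp add: fconc_diff_left fconc_diff_right)
  hence "emb (m + n) (fconc x y) - emb (m + n) (fconc x' y') =
      emb (m + n) (fconc (x - x') y) + emb (m + n) (fconc x' (y - y'))"
    using assms by (simp add: emb_diff[symmetric] emb_add[symmetric] free_tensors_fconc free_tensors_diff)
  also have "norm \<dots> \<le> norm (emb (m + n) (fconc (x - x') y)) + norm (emb (m + n) (fconc x' (y - y')))"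
    by (rule norm_triangle_ineq)
  also have "\<dots> \<le> norm (emb m (x - x')) * norm (emb n y) + norm (emb m x') * norm (emb n (y - y'))"
    using assms by (intro add_mono norm_emb_fconc_le free_tensors_diff)
  finally show ?thesis using assms by (simp add: emb_diff)
qed

definition approximates :: "nat \<Rightarrow> (nat \<Rightarrow> 'v list \<Rightarrow>\<^sub>0 'f) \<Rightarrow> 'w \<Rightarrow> bool" where
  "approximates n x \<xi> \<longleftrightarrow> (\<forall>k. x k \<in> free_tensors n) \<and> (\<lambda>k. emb n (x k)) \<longlonglongrightarrow> \<xi>"

lemma tpow_approximates: "\<xi> \<in> tpow emb n \<longleftrightarrow> (\<exists>x. approximates n x \<xi>)"
proof
  assume "\<xi> \<in> tpow emb n"
  then obtain w where w: "\<And>k. w k \<in> emb n ` free_tensors n" "w \<longlonglongrightarrow> \<xi>"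
    unfolding tpow_def closure_sequential by blast
  then obtain x where "\<And>k. x k \<in> free_tensors n \<and> w k = emb n (x k)"
    using choice[of "\<lambda>k z. z \<in> free_tensors n \<and> w k = emb n z"] by (auto simp: image_iff Bex_def)
  moreover from this have "w = (\<lambda>k. emb n (x k))" by auto
  ultimately have "approximates n x \<xi>" using w(2) by (simp add: approximates_def)
  thus "\<exists>x. approximates n x \<xi>" by blast
next
  assume "\<exists>x. approximates n x \<xi>"
  then obtain x where x: "\<And>k. x k \<in> free_tensors n" "(\<lambda>k. emb n (x k)) \<longlonglongrightarrow> \<xi>"
    by (auto simp: approximates_def)
  show "\<xi> \<in> tpow emb n"
    unfolding tpow_def closure_sequential
    by (rule exI[of _ "\<lambda>k. emb n (x k)"]) (use x in simp)
qed

lemma emb_fconc_Cauchy: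
  assumes x: "approximates m x \<xi>" and y: "approximates n y \<eta>"
  shows "Cauchy (\<lambda>k. emb (m + n) (fconc (x k) (y k)))"
proof -
  let ?u = "\<lambda>k. emb (m + n) (fconc (x k) (y k))"
  have xf: "\<And>k. x k \<in> free_tensors m" and yf: "\<And>k. y k \<in> free_tensors n"
    and xl: "(\<lambda>k. emb m (x k)) \<longlonglongrightarrow> \<xi>" and yl: "(\<lambda>k. emb n (y k)) \<longlonglongrightarrow> \<eta>"
    using x y by (auto simp: approximates_def)
  have "Bseq (\<lambda>k. emb m (x k))" "Bseq (\<lambda>k. emb n (y k))"
    by (rule convergent_imp_Bseq[OF convergentI[OF xl]], rule convergent_imp_Bseq[OF convergentI[OF yl]])
  then obtain P Q where P: "0 < P" "\<And>k. norm (emb m (x k)) \<le> P"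
    and Q: "0 < Q" "\<And>k. norm (emb n (y k)) \<le> Q"
    by (auto simp: Bseq_def)
  show ?thesis
  proof (rule CauchyI)
    fix e :: real assume e: "0 < e"
    have "0 < e / (2 * Q)" "0 < e / (2 * P)" using e P(1) Q(1) by auto
    from CauchyD[OF LIMSEQ_imp_Cauchy[OF xl] this(1)] CauchyD[OF LIMSEQ_imp_Cauchy[OF yl] this(2)]
    obtain M N where
      M: "\<forall>j\<ge>M. \<forall>k\<ge>M. norm (emb m (x j) - emb m (x k)) < e / (2 * Q)" and
      N: "\<forall>j\<ge>N. \<forall>k\<ge>N. norm (emb n (y j) - emb n (y k)) < e / (2 * P)"
      by (elim exE)
    have "norm (?u j - ?u k) < e" if jk: "max M N \<le> j" "max M N \<le> k" for j k
    proof -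
      have "norm (?u j - ?u k) \<le> norm (emb m (x j) - emb m (x k)) * norm (emb n (y j))
          + norm (emb m (x k)) * norm (emb n (y j) - emb n (y k))"
        by (intro norm_emb_fconc_diff_le xf yf)
      also have "\<dots> \<le> norm (emb m (x j) - emb m (x k)) * Q + P * norm (emb n (y j) - emb n (y k))"
        by (intro add_mono mult_left_mono mult_right_mono P(2) Q(2)) auto
      also have "\<dots> < e / (2 * Q) * Q + P * (e / (2 * P))"
        using jk P(1) Q(1) by (intro add_strict_mono mult_strict_right_mono mult_strict_left_mono
            M[rule_format] N[rule_format]) auto
      also have "\<dots> = e" using P(1) Q(1) by (simp add: field_simps)
      finally show ?thesis .
    qed
    thus "\<exists>L. \<forall>j\<ge>L. \<forall>k\<ge>L. norm (?u j - ?u k) < e" by blast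
  qed
qed

text \<open>
  This justifies the definite description in the definition of \<open>tens\<close>: the limit exists by completeness, and
  it does not depend on the approximating sequences.  Every algebraic property of \<open>tens\<close> passes to the limit
  from representatives through this lemma.
\<close>
lemma tens_tendsto:
  assumes x: "approximates m x \<xi>" and y: "approximates n y \<eta>"
  shows "(\<lambda>k. emb (m + n) (fconc (x k) (y k))) \<longlonglongrightarrow> tens emb m n \<xi> \<eta>"
proof -
  obtain \<zeta> where \<zeta>: "(\<lambda>k. emb (m + n) (fconc (x k) (y k))) \<longlonglongrightarrow> \<zeta>"
    using emb_fconc_Cauchy[OF x y] by (auto simp: Cauchy_convergent_iff convergent_def)
  have xf: "\<And>k. x k \<in> free_tensors m" and yf: "\<And>k. y k \<in> free_tensors n"
    and xl: "(\<lambda>k. emb m (x k)) \<longlonglongrightarrow> \<xi>" and yl: "(\<lambda>k. emb n (y k)) \<longlonglongrightarrow> \<eta>"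
    using x y by (auto simp: approximates_def)
  let ?lim = "\<lambda>\<zeta>. \<forall>x y.
     (\<forall>k. x k \<in> free_tensors m) \<and> (\<lambda>k. emb m (x k)) \<longlonglongrightarrow> \<xi> \<and>
     (\<forall>k. y k \<in> free_tensors n) \<and> (\<lambda>k. emb n (y k)) \<longlonglongrightarrow> \<eta> \<longrightarrow>
     (\<lambda>k. emb (m + n) (fconc (x k) (y k))) \<longlonglongrightarrow> \<zeta>"
  have lim: "?lim \<zeta>"
  proof (intro allI impI, elim conjE)
    fix x' y'
    assume x'f: "\<forall>k. x' k \<in> free_tensors m" and x'l: "(\<lambda>k. emb m (x' k)) \<longlonglongrightarrow> \<xi>"
      and y'f: "\<forall>k. y' k \<in> free_tensors n" and y'l: "(\<lambda>k. emb n (y' k)) \<longlonglongrightarrow> \<eta>"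
    let ?d = "\<lambda>k. emb (m + n) (fconc (x' k) (y' k)) - emb (m + n) (fconc (x k) (y k))"
    have "(\<lambda>k. norm (emb m (x' k) - emb m (x k)) * norm (emb n (y' k))
        + norm (emb m (x k)) * norm (emb n (y' k) - emb n (y k)))
        \<longlonglongrightarrow> norm (\<xi> - \<xi>) * norm \<eta> + norm \<xi> * norm (\<eta> - \<eta>)"
      by (intro tendsto_intros xl yl x'l y'l)
    hence "(\<lambda>k. norm (emb m (x' k) - emb m (x k)) * norm (emb n (y' k))
        + norm (emb m (x k)) * norm (emb n (y' k) - emb n (y k))) \<longlonglongrightarrow> 0"
      by simp
    hence "?d \<longlonglongrightarrow> 0"
      by (rule Lim_null_comparison[rotated])
        (intro always_eventually allI norm_emb_fconc_diff_le x'f[rule_format] y'f[rule_format] xf yf)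
    from tendsto_add[OF this \<zeta>]
    show "(\<lambda>k. emb (m + n) (fconc (x' k) (y' k))) \<longlonglongrightarrow> \<zeta>" by simp
  qed
  have unique: "\<zeta>' = \<zeta>" if "?lim \<zeta>'" for \<zeta>'
    by (rule LIMSEQ_unique[OF _ \<zeta>], rule that[rule_format]) (intro conjI allI xf yf xl yl)
  have "tens emb m n \<xi> \<eta> = \<zeta>"
    unfolding tens_def
  proof (rule the_equality)
    show "?lim \<zeta>" by (rule lim)
  qed (rule unique)
  thus ?thesis using \<zeta> by simp
qed

lemma tens_eqI:
  "approximates m x \<xi> \<Longrightarrow> approximates n y \<eta> \<Longrightarrow>
    (\<lambda>k. emb (m + n) (fconc (x k) (y k))) \<longlonglongrightarrow> \<zeta> \<Longrightarrow> tens emb m n \<xi> \<eta> = \<zeta>"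
  by (rule LIMSEQ_unique[OF tens_tendsto])

lemma approximates_tens:
  "approximates m x \<xi> \<Longrightarrow> approximates n y \<eta> \<Longrightarrow>
    approximates (m + n) (\<lambda>k. fconc (x k) (y k)) (tens emb m n \<xi> \<eta>)"
  using tens_tendsto[of m x \<xi> n y \<eta>] by (simp add: approximates_def free_tensors_fconc)

lemma approximates_add:
  "approximates n x \<xi> \<Longrightarrow> approximates n y \<eta> \<Longrightarrow> approximates n (\<lambda>k. x k + y k) (\<xi> + \<eta>)"
  by (simp add: approximates_def free_tensors_add emb_add tendsto_add)

lemma approximates_scaleR:
  "approximates n x \<xi> \<Longrightarrow> approximates n (\<lambda>k. fscale (of_real r) (x k)) (r *\<^sub>R \<xi>)"
  by (simp add: approximates_def free_tensors_fscale emb_scaleR tendsto_scaleR)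

lemma approximates_emb: "x \<in> free_tensors n \<Longrightarrow> approximates n (\<lambda>_. x) (emb n x)"
  by (simp add: approximates_def)

lemma tpow_zero: "0 \<in> tpow emb n"
  using approximates_emb[of 0 n] by (auto simp: tpow_approximates free_tensors_0 emb_zero)

lemma tpow_add: "\<xi> \<in> tpow emb n \<Longrightarrow> \<eta> \<in> tpow emb n \<Longrightarrow> \<xi> + \<eta> \<in> tpow emb n"
  unfolding tpow_approximates by (elim exE) (rule exI, rule approximates_add)

lemma tpow_scaleR: "\<xi> \<in> tpow emb n \<Longrightarrow> r *\<^sub>R \<xi> \<in> tpow emb n"
  unfolding tpow_approximates by (elim exE) (rule exI, rule approximates_scaleR)

lemma tpow_sum: "(\<And>i. i \<in> I \<Longrightarrow> f i \<in> tpow emb n) \<Longrightarrow> sum f I \<in> tpow emb n"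
  by (induction I rule: infinite_finite_induct) (auto intro: tpow_zero tpow_add)

lemma tpow_tens: "\<xi> \<in> tpow emb m \<Longrightarrow> \<eta> \<in> tpow emb n \<Longrightarrow> tens emb m n \<xi> \<eta> \<in> tpow emb (m + n)"
  unfolding tpow_approximates by (elim exE) (rule exI, rule approximates_tens)

lemma tens_add_left:
  assumes "\<xi> \<in> tpow emb m" "\<xi>' \<in> tpow emb m" "\<eta> \<in> tpow emb n"
  shows "tens emb m n (\<xi> + \<xi>') \<eta> = tens emb m n \<xi> \<eta> + tens emb m n \<xi>' \<eta>"
proof -
  obtain x x' y where a: "approximates m x \<xi>" "approximates m x' \<xi>'" "approximates n y \<eta>"
    using assms by (auto simp: tpow_approximates)
  have "approximates (m + n) (\<lambda>k. fconc (x k + x' k) (y k)) (tens emb m n \<xi> \<eta> + tens emb m n \<xi>' \<eta>)"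
    unfolding fconc_add_left by (intro approximates_add approximates_tens a)
  thus ?thesis
    by (intro tens_eqI[OF approximates_add[OF a(1,2)] a(3)]) (simp add: approximates_def)
qed

lemma tens_add_right:
  assumes "\<xi> \<in> tpow emb m" "\<eta> \<in> tpow emb n" "\<eta>' \<in> tpow emb n"
  shows "tens emb m n \<xi> (\<eta> + \<eta>') = tens emb m n \<xi> \<eta> + tens emb m n \<xi> \<eta>'"
proof -
  obtain x y y' where a: "approximates m x \<xi>" "approximates n y \<eta>" "approximates n y' \<eta>'"
    using assms by (auto simp: tpow_approximates)
  have "approximates (m + n) (\<lambda>k. fconc (x k) (y k + y' k)) (tens emb m n \<xi> \<eta> + tens emb m n \<xi> \<eta>')"
    unfolding fconc_add_right by (intro approximates_add approximates_tens a)
  thus ?thesis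
    by (intro tens_eqI[OF a(1) approximates_add[OF a(2,3)]]) (simp add: approximates_def)
qed

lemma tens_scaleR_left:
  assumes "\<xi> \<in> tpow emb m" "\<eta> \<in> tpow emb n"
  shows "tens emb m n (r *\<^sub>R \<xi>) \<eta> = r *\<^sub>R tens emb m n \<xi> \<eta>"
proof -
  obtain x y where a: "approximates m x \<xi>" "approximates n y \<eta>"
    using assms by (auto simp: tpow_approximates)
  have "approximates (m + n) (\<lambda>k. fconc (fscale (of_real r) (x k)) (y k)) (r *\<^sub>R tens emb m n \<xi> \<eta>)"
    unfolding fconc_fscale_left by (intro approximates_scaleR approximates_tens a)
  thus ?thesis
    by (intro tens_eqI[OF approximates_scaleR[OF a(1)] a(2)]) (simp add: approximates_def)
qed

lemma tens_scaleR_right: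
  assumes "\<xi> \<in> tpow emb m" "\<eta> \<in> tpow emb n"
  shows "tens emb m n \<xi> (r *\<^sub>R \<eta>) = r *\<^sub>R tens emb m n \<xi> \<eta>"
proof -
  obtain x y where a: "approximates m x \<xi>" "approximates n y \<eta>"
    using assms by (auto simp: tpow_approximates)
  have "approximates (m + n) (\<lambda>k. fconc (x k) (fscale (of_real r) (y k))) (r *\<^sub>R tens emb m n \<xi> \<eta>)"
    unfolding fconc_fscale_right by (intro approximates_scaleR approximates_tens a)
  thus ?thesis
    by (intro tens_eqI[OF a(1) approximates_scaleR[OF a(2)]]) (simp add: approximates_def)
qed

lemma tens_zero_left: "\<eta> \<in> tpow emb n \<Longrightarrow> tens emb m n 0 \<eta> = 0"
  using tens_scaleR_left[of 0 m \<eta> n 0] by (simp add: tpow_zero)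

lemma tens_zero_right: "\<xi> \<in> tpow emb m \<Longrightarrow> tens emb m n \<xi> 0 = 0"
  using tens_scaleR_right[of \<xi> m 0 n 0] by (simp add: tpow_zero)

lemma tens_sum_left:
  "(\<And>i. i \<in> I \<Longrightarrow> f i \<in> tpow emb m) \<Longrightarrow> \<eta> \<in> tpow emb n \<Longrightarrow>
    tens emb m n (sum f I) \<eta> = (\<Sum>i\<in>I. tens emb m n (f i) \<eta>)"
  by (induction I rule: infinite_finite_induct) (auto simp: tens_zero_left tens_add_left tpow_sum)

lemma tens_sum_right:
  "\<xi> \<in> tpow emb m \<Longrightarrow> (\<And>i. i \<in> I \<Longrightarrow> f i \<in> tpow emb n) \<Longrightarrow>
    tens emb m n \<xi> (sum f I) = (\<Sum>i\<in>I. tens emb m n \<xi> (f i))"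
  by (induction I rule: infinite_finite_induct) (auto simp: tens_zero_right tens_add_right tpow_sum)

lemma norm_tens_le:
  assumes "\<xi> \<in> tpow emb m" "\<eta> \<in> tpow emb n"
  shows "norm (tens emb m n \<xi> \<eta>) \<le> norm \<xi> * norm \<eta>"
proof -
  obtain x y where a: "approximates m x \<xi>" "approximates n y \<eta>"
    using assms by (auto simp: tpow_approximates)
  have "(\<lambda>k. norm (emb (m + n) (fconc (x k) (y k)))) \<longlonglongrightarrow> norm (tens emb m n \<xi> \<eta>)"
    by (intro tendsto_norm tens_tendsto a)
  moreover have "(\<lambda>k. norm (emb m (x k)) * norm (emb n (y k))) \<longlonglongrightarrow> norm \<xi> * norm \<eta>"
    using a by (intro tendsto_intros) (auto simp: approximates_def)
  ultimately show ?thesis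
    using a by (intro LIMSEQ_le) (auto intro!: norm_emb_fconc_le simp: approximates_def)
qed

lemma tens_assoc:
  assumes "\<xi> \<in> tpow emb i" "\<eta> \<in> tpow emb j" "\<zeta> \<in> tpow emb k"
  shows "tens emb (i + j) k (tens emb i j \<xi> \<eta>) \<zeta> = tens emb i (j + k) \<xi> (tens emb j k \<eta> \<zeta>)"
proof -
  obtain x y z where a: "approximates i x \<xi>" "approximates j y \<eta>" "approximates k z \<zeta>"
    using assms by (auto simp: tpow_approximates)
  have "approximates (i + (j + k)) (\<lambda>n. fconc (x n) (fconc (y n) (z n)))
      (tens emb i (j + k) \<xi> (tens emb j k \<eta> \<zeta>))"
    by (intro approximates_tens a)
  thus ?thesis
    by (intro tens_eqI[OF approximates_tens[OF a(1,2)] a(3)])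
      (simp add: approximates_def fconc_assoc add.assoc)
qed

lemma unit_in_tpow: "emb 0 (elem []) \<in> tpow emb 0"
  using approximates_emb[of "elem []" 0] by (auto simp: tpow_approximates free_tensors_single)

lemma tens_unit_left:
  assumes "\<eta> \<in> tpow emb n"
  shows "tens emb 0 n (emb 0 (elem [])) \<eta> = \<eta>"
proof -
  obtain y where y: "approximates n y \<eta>"
    using assms by (auto simp: tpow_approximates)
  thus ?thesis
    by (intro tens_eqI[OF approximates_emb y])
      (simp_all add: free_tensors_single fconc_unit_left fscale_one approximates_def)
qed

lemma tens_unit_right:
  assumes "\<xi> \<in> tpow emb n"
  shows "tens emb n 0 \<xi> (emb 0 (elem [])) = \<xi>"
proof -
  obtain x where x: "approximates n x \<xi>"
    using assms by (auto simp: tpow_approximates)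
  thus ?thesis
    by (intro tens_eqI[OF x approximates_emb])
      (simp_all add: free_tensors_single fconc_unit_right fscale_one approximates_def)
qed

lemma norm_unit: "norm (emb 0 (elem [])) = 1"
  using nrm by (simp add: norm_emb free_tensors_single reasonable_tensor_norms_def)

section \<open>The algebra of tensor series\<close>

lemma tensor_seriesD: "g \<in> tensor_series emb \<Longrightarrow> g n \<in> tpow emb n"
  by (simp add: tensor_series_def)

lemma tone_in_series: "tone emb \<in> tensor_series emb"
  by (simp add: tensor_series_def tone_def unit_in_tpow tpow_zero)

lemma tpow_tens_diff:
  "i \<le> n \<Longrightarrow> \<xi> \<in> tpow emb i \<Longrightarrow> \<eta> \<in> tpow emb (n - i) \<Longrightarrow> tens emb i (n - i) \<xi> \<eta> \<in> tpow emb n"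
  using tpow_tens[of \<xi> i \<eta> "n - i"] by simp

lemma tmul_in_series:
  "g \<in> tensor_series emb \<Longrightarrow> h \<in> tensor_series emb \<Longrightarrow> tmul emb g h \<in> tensor_series emb"
  unfolding tensor_series_def tmul_def
  by (auto intro!: tpow_sum tpow_tens_diff)

lemma tmul_assoc:
  assumes g: "g \<in> tensor_series emb" and h: "h \<in> tensor_series emb" and k: "k \<in> tensor_series emb"
  shows "tmul emb (tmul emb g h) k = tmul emb g (tmul emb h k)"
proof
  fix n
  note mem = tensor_seriesD[OF g] tensor_seriesD[OF h] tensor_seriesD[OF k]
  define F where "F i j l = tens emb (i + j) l (tens emb i j (g i) (h j)) (k l)" for i j l
  have "tmul emb (tmul emb g h) k n = (\<Sum>i=0..n. \<Sum>j=0..i. F j (i - j) (n - i))"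
    unfolding tmul_def atLeast0AtMost
  proof (rule sum.cong[OF refl])
    fix i
    show "tens emb i (n - i) (\<Sum>j\<le>i. tens emb j (i - j) (g j) (h (i - j))) (k (n - i))
        = (\<Sum>j\<le>i. F j (i - j) (n - i))"
      by (subst tens_sum_left) (auto intro: tpow_tens_diff mem simp: F_def)
  qed
  also have "\<dots> = (\<Sum>i=0..n. \<Sum>j=0..n - i. F i j (n - i - j))"
    by (rule fps_mult_assoc_lemma)
  also have "\<dots> = tmul emb g (tmul emb h k) n"
    unfolding tmul_def atLeast0AtMost
  proof (rule sum.cong[OF refl])
    fix i
    show "(\<Sum>j\<le>n - i. F i j (n - i - j)) =
        tens emb i (n - i) (g i) (\<Sum>j\<le>n - i. tens emb j (n - i - j) (h j) (k (n - i - j)))"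
    proof (subst tens_sum_right)
      show "tens emb j (n - i - j) (h j) (k (n - i - j)) \<in> tpow emb (n - i)" if "j \<in> {..n - i}" for j
        using that by (intro tpow_tens_diff mem) auto
    qed (simp_all add: F_def tens_assoc mem del: diff_diff_left)
  qed
  finally show "tmul emb (tmul emb g h) k n = tmul emb g (tmul emb h k) n" .
qed

lemma tmul_tone_left:
  assumes "g \<in> tensor_series emb"
  shows "tmul emb (tone emb) g = g"
proof
  fix n
  have "tmul emb (tone emb) g n = (\<Sum>i\<in>{0}. tens emb i (n - i) (tone emb i) (g (n - i)))"
    unfolding tmul_def
    by (rule sum.mono_neutral_right) (auto simp: tone_def tens_zero_left tensor_seriesD assms)
  thus "tmul emb (tone emb) g n = g n"
    by (simp add: tone_def tens_unit_left tensor_seriesD assms)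
qed

lemma tmul_tone_right:
  assumes "g \<in> tensor_series emb"
  shows "tmul emb g (tone emb) = g"
proof
  fix n
  have "tmul emb g (tone emb) n = (\<Sum>i\<in>{n}. tens emb i (n - i) (g i) (tone emb (n - i)))"
    unfolding tmul_def
    by (rule sum.mono_neutral_right) (auto simp: tone_def tens_zero_right tensor_seriesD assms)
  thus "tmul emb g (tone emb) n = g n"
    by (simp add: tone_def tens_unit_right tensor_seriesD assms)
qed

lemma trunc_in_series: "g \<in> tensor_series emb \<Longrightarrow> trunc N g \<in> tensor_series emb"
  by (simp add: tensor_series_def trunc_def tpow_zero)

lemma trunc_tensors_eq: "trunc_tensors emb N = {g \<in> tensor_series emb. trunc N g = g}"
  by (auto simp: trunc_tensors_def trunc_def fun_eq_iff not_le)

lemma trunc_trunc: "trunc N (trunc N g) = trunc N g"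
  by (simp add: trunc_def fun_eq_iff)

lemma trunc_tone: "trunc N (tone emb) = tone emb"
  by (simp add: trunc_def tone_def fun_eq_iff)

lemma tmul_trunc_trunc:
  "tmul_trunc emb N (trunc N g) h = trunc N (tmul emb g h)"
  "tmul_trunc emb N g (trunc N h) = trunc N (tmul emb g h)"
  by (auto simp: tmul_trunc_def trunc_def tmul_def fun_eq_iff intro!: sum.cong)

lemma tmul_trunc_assoc:
  assumes "g \<in> tensor_series emb" "h \<in> tensor_series emb" "k \<in> tensor_series emb"
  shows "tmul_trunc emb N (tmul_trunc emb N g h) k = tmul_trunc emb N g (tmul_trunc emb N h k)"
  using tmul_assoc[OF assms] tmul_trunc_trunc(1)[of N "tmul emb g h" k]
    tmul_trunc_trunc(2)[of N g "tmul emb h k"]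
  by (simp add: tmul_trunc_def)

text \<open>Two-sided inverses are unique in a monoid, so exhibiting one determines the described element.\<close>
lemma tinv_trunc_eqI:
  assumes g: "g \<in> tensor_series emb" and h: "h \<in> trunc_tensors emb N"
    and gh: "tmul_trunc emb N g h = tone emb" and hg: "tmul_trunc emb N h g = tone emb"
  shows "tinv_trunc emb N g = h"
  unfolding tinv_trunc_def
proof (rule the_equality)
  show "h \<in> trunc_tensors emb N \<and> tmul_trunc emb N g h = tone emb \<and> tmul_trunc emb N h g = tone emb"
    using assms by simp
next
  fix h' assume h': "h' \<in> trunc_tensors emb N \<and> tmul_trunc emb N g h' = tone emb
    \<and> tmul_trunc emb N h' g = tone emb"
  have mem: "h \<in> tensor_series emb" "h' \<in> tensor_series emb" "trunc N h = h" "trunc N h' = h'"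
    using h h' by (auto simp: trunc_tensors_eq)
  have "h' = tmul_trunc emb N (tmul_trunc emb N h g) h'"
    unfolding hg using mem by (simp add: tmul_trunc_def tmul_tone_left)
  also have "\<dots> = tmul_trunc emb N h (tmul_trunc emb N g h')"
    using g mem by (simp add: tmul_trunc_assoc)
  also have "\<dots> = h"
    using h' mem by (simp add: tmul_trunc_def tmul_tone_right)
  finally show "h' = h" .
qed

end


section \<open>Exponentials of tensor series\<close>

context tensor_algebra
begin

definition tpower :: "(nat \<Rightarrow> 'w) \<Rightarrow> nat \<Rightarrow> nat \<Rightarrow> 'w" where
  "tpower l k = (tmul emb l ^^ k) (tone emb)"

text \<open>
  The coefficient of degree \<open>n\<close> of \<open>exp(tl)\<close>.  For \<open>\<pi>\<^sub>0(l) = 0\<close> the powers \<open>l\<^sup>k\<close> with \<open>k > n\<close> vanish in degree \<open>n\<close>,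
  so the exponential series may be cut at \<open>n\<close>.
\<close>
definition texp :: "(nat \<Rightarrow> 'w) \<Rightarrow> real \<Rightarrow> nat \<Rightarrow> 'w" where
  "texp l t n = (\<Sum>k\<le>n. (t ^ k / fact k) *\<^sub>R tpower l k n)"

lemma tpower_0: "tpower l 0 = tone emb"
  by (simp add: tpower_def)

lemma tpower_Suc: "tpower l (Suc k) = tmul emb l (tpower l k)"
  by (simp add: tpower_def)

context
  fixes l :: "nat \<Rightarrow> 'w"
  assumes l: "l \<in> tensor_series emb" and l_0: "l 0 = 0"
begin

lemma tpower_in_series: "tpower l k \<in> tensor_series emb"
  by (induction k) (simp_all add: tpower_0 tpower_Suc tone_in_series tmul_in_series l)

lemma tpower_in_tpow: "tpower l k n \<in> tpow emb n"
  by (rule tensor_seriesD[OF tpower_in_series])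

lemma tpower_add: "tmul emb (tpower l i) (tpower l j) = tpower l (i + j)"
  by (induction i)
    (simp_all add: tpower_0 tpower_Suc tmul_tone_left tmul_assoc l tpower_in_series)

lemma tpower_eq_0_below: "n < k \<Longrightarrow> tpower l k n = 0"
proof (induction k arbitrary: n)
  case (Suc k)
  have "tens emb i (n - i) (l i) (tpower l k (n - i)) = 0" if "i \<le> n" for i
  proof (cases "i = 0")
    case True
    thus ?thesis by (simp add: l_0 tens_zero_left tpower_in_tpow)
  next
    case False
    hence "tpower l k (n - i) = 0" using Suc that by simp
    thus ?thesis by (simp add: tens_zero_right tensor_seriesD l)
  qed
  thus ?case by (simp add: tpower_Suc tmul_def)
qed simp

lemma tpower_eq_0_above:
  assumes m: "\<And>i. m < i \<Longrightarrow> l i = 0"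
  shows "k * m < n \<Longrightarrow> tpower l k n = 0"
proof (induction k arbitrary: n)
  case 0
  thus ?case by (simp add: tpower_0 tone_def)
next
  case (Suc k)
  have "tens emb i (n - i) (l i) (tpower l k (n - i)) = 0" if "i \<le> n" for i
  proof (cases "m < i")
    case True
    thus ?thesis by (simp add: m tens_zero_left tpower_in_tpow)
  next
    case False
    hence "k * m < n - i" using Suc.prems by simp
    thus ?thesis by (simp add: Suc.IH tens_zero_right tensor_seriesD l)
  qed
  thus ?case by (simp add: tpower_Suc tmul_def)
qed

text \<open>
  The weighted sum \<open>\<Sum>\<^sub>n \<parallel>g\<^sub>n\<parallel> r\<^sup>n\<close> is submultiplicative: expanding a product produces the pairs of degrees with
  \<open>i + j \<le> N\<close>, which are contained in the square that the product of the two sums runs over.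
\<close>
lemma tpower_weighted_norm_le:
  assumes m: "\<And>i. m < i \<Longrightarrow> l i = 0" and r: "0 \<le> r"
  shows "(\<Sum>n\<le>N. norm (tpower l k n) * r ^ n) \<le> (\<Sum>i\<le>m. norm (l i) * r ^ i) ^ k"
proof (induction k arbitrary: N)
  case 0
  have "(\<Sum>n\<le>N. norm (tone emb n) * r ^ n) = (\<Sum>n\<in>{0}. norm (tone emb n) * r ^ n)"
    by (rule sum.mono_neutral_right) (auto simp: tone_def)
  thus ?case by (simp add: tpower_0) (simp add: tone_def norm_unit)
next
  case (Suc k)
  define P where "P = (\<Sum>i\<le>m. norm (l i) * r ^ i)"
  have P: "(\<Sum>i\<le>N. norm (l i) * r ^ i) \<le> P"
  proof -
    have "(\<Sum>i\<le>N. norm (l i) * r ^ i) \<le> (\<Sum>i\<le>max N m. norm (l i) * r ^ i)"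
      using r by (intro sum_mono2) auto
    also have "\<dots> = P" unfolding P_def using m by (intro sum.mono_neutral_right) auto
    finally show ?thesis .
  qed
  have "0 \<le> P" unfolding P_def using r by (intro sum_nonneg) auto
  define G where "G i j = (norm (l i) * r ^ i) * (norm (tpower l k j) * r ^ j)" for i j
  have "norm (tpower l (Suc k) n) * r ^ n \<le> (\<Sum>i\<le>n. G i (n - i))" for n
  proof -
    have "norm (tpower l (Suc k) n) \<le> (\<Sum>i\<le>n. norm (l i) * norm (tpower l k (n - i)))"
      unfolding tpower_Suc tmul_def
      by (intro sum_norm_le norm_tens_le tensor_seriesD l tpower_in_tpow)
    hence "norm (tpower l (Suc k) n) * r ^ n
        \<le> (\<Sum>i\<le>n. norm (l i) * norm (tpower l k (n - i))) * r ^ n"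
      using r by (intro mult_right_mono) auto
    also have "\<dots> = (\<Sum>i\<le>n. norm (l i) * norm (tpower l k (n - i)) * (r ^ i * r ^ (n - i)))"
      by (simp add: sum_distrib_right power_add[symmetric])
    also have "\<dots> = (\<Sum>i\<le>n. G i (n - i))"
      by (simp add: G_def mult_ac)
    finally show ?thesis .
  qed
  hence "(\<Sum>n\<le>N. norm (tpower l (Suc k) n) * r ^ n) \<le> (\<Sum>n\<le>N. \<Sum>i\<le>n. G i (n - i))"
    by (intro sum_mono)
  also have "\<dots> = (\<Sum>(i, j)\<in>{(i, j). i + j \<le> N}. G i j)"
    by (rule sum.triangle_reindex_eq[symmetric])
  also have "\<dots> \<le> (\<Sum>(i, j)\<in>{..N} \<times> {..N}. G i j)"
    using r by (intro sum_mono2) (auto simp: G_def)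
  also have "\<dots> = (\<Sum>i\<le>N. norm (l i) * r ^ i) * (\<Sum>j\<le>N. norm (tpower l k j) * r ^ j)"
    by (simp add: sum.cartesian_product[symmetric] G_def sum_product)
  also have "\<dots> \<le> P * P ^ k"
    using P Suc.IH[of N] r \<open>0 \<le> P\<close> unfolding P_def[symmetric]
    by (intro mult_mono) (auto intro: sum_nonneg)
  finally show ?case by (simp add: P_def)
qed

lemma texp_in_series: "texp l t \<in> tensor_series emb"
  unfolding tensor_series_def texp_def by (auto intro!: tpow_sum tpow_scaleR tpower_in_tpow)

lemma texp_degree_0: "texp l t 0 = tone emb 0"
  by (simp add: texp_def tpower_0)

lemma texp_eq_sum: "n \<le> N \<Longrightarrow> texp l t n = (\<Sum>k\<le>N. (t ^ k / fact k) *\<^sub>R tpower l k n)"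
  unfolding texp_def by (intro sum.mono_neutral_left) (auto simp: tpower_eq_0_below)

lemma texp_zero: "texp l 0 = tone emb"
proof
  fix n
  have "texp l 0 n = (\<Sum>k\<in>{0}. (0 ^ k / fact k) *\<^sub>R tpower l k n)"
    unfolding texp_def by (rule sum.mono_neutral_right) auto
  thus "texp l 0 n = tone emb n" by (simp add: tpower_0)
qed

text \<open>
  Both factors are written with the same cut-off \<open>n\<close>; the square of index pairs \<open>(a, b)\<close> may then be reduced to the
  triangle \<open>a + b \<le> n\<close>, because \<open>l\<^bsup>a+b\<^esup>\<close> has no part of degree \<open>n\<close> outside it, and the binomial theorem applies.
\<close>
lemma texp_add: "tmul emb (texp l s) (texp l t) = texp l (s + t)"
proof
  fix n
  define c where "c a b = s ^ a / fact a * (t ^ b / fact b)" for a b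
  have "tmul emb (texp l s) (texp l t) n =
      (\<Sum>i\<le>n. \<Sum>a\<le>n. \<Sum>b\<le>n. c a b *\<^sub>R tens emb i (n - i) (tpower l a i) (tpower l b (n - i)))"
    unfolding tmul_def
  proof (rule sum.cong[OF refl])
    fix i assume "i \<in> {..n}"
    hence "tens emb i (n - i) (texp l s i) (texp l t (n - i)) = tens emb i (n - i)
        (\<Sum>a\<le>n. (s ^ a / fact a) *\<^sub>R tpower l a i) (\<Sum>b\<le>n. (t ^ b / fact b) *\<^sub>R tpower l b (n - i))"
      by (simp add: texp_eq_sum[of i n] texp_eq_sum[of "n - i" n])
    also have "\<dots> = (\<Sum>a\<le>n. (s ^ a / fact a) *\<^sub>R tens emb i (n - i) (tpower l a i)
        (\<Sum>b\<le>n. (t ^ b / fact b) *\<^sub>R tpower l b (n - i)))"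
      by (simp only: tens_sum_left tens_scaleR_left tpow_sum tpow_scaleR tpower_in_tpow)
    also have "\<dots> = (\<Sum>a\<le>n. \<Sum>b\<le>n. c a b *\<^sub>R tens emb i (n - i) (tpower l a i) (tpower l b (n - i)))"
      by (simp add: c_def tens_sum_right tens_scaleR_right tpow_scaleR tpower_in_tpow scaleR_sum_right)
    finally show "tens emb i (n - i) (texp l s i) (texp l t (n - i)) =
      (\<Sum>a\<le>n. \<Sum>b\<le>n. c a b *\<^sub>R tens emb i (n - i) (tpower l a i) (tpower l b (n - i)))" .
  qed
  also have "\<dots> = (\<Sum>a\<le>n. \<Sum>b\<le>n. \<Sum>i\<le>n. c a b *\<^sub>R tens emb i (n - i) (tpower l a i) (tpower l b (n - i)))"
    by (subst sum.swap, rule sum.cong[OF refl], rule sum.swap)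
  also have "\<dots> = (\<Sum>a\<le>n. \<Sum>b\<le>n. c a b *\<^sub>R tpower l (a + b) n)"
    unfolding scaleR_sum_right[symmetric] tpower_add[symmetric] tmul_def ..
  also have "\<dots> = (\<Sum>(a, b)\<in>{..n} \<times> {..n}. c a b *\<^sub>R tpower l (a + b) n)"
    by (rule sum.cartesian_product)
  also have "\<dots> = (\<Sum>(a, b)\<in>{(a, b). a + b \<le> n}. c a b *\<^sub>R tpower l (a + b) n)"
    by (rule sum.mono_neutral_right) (auto, meson not_le tpower_eq_0_below)
  also have "\<dots> = (\<Sum>k\<le>n. \<Sum>a\<le>k. c a (k - a) *\<^sub>R tpower l (a + (k - a)) n)"
    by (rule sum.triangle_reindex_eq)
  also have "\<dots> = (\<Sum>k\<le>n. ((s + t) ^ k / fact k) *\<^sub>R tpower l k n)"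
  proof (rule sum.cong[OF refl])
    fix k
    have "(\<Sum>a\<le>k. c a (k - a)) = (s + t) ^ k / fact k"
      unfolding binomial_ring sum_divide_distrib
      by (rule sum.cong[OF refl]) (simp add: c_def binomial_fact field_simps)
    thus "(\<Sum>a\<le>k. c a (k - a) *\<^sub>R tpower l (a + (k - a)) n) = ((s + t) ^ k / fact k) *\<^sub>R tpower l k n"
      by (simp add: scaleR_sum_left[symmetric])
  qed
  finally show "tmul emb (texp l s) (texp l t) n = texp l (s + t) n"
    by (simp add: texp_def)
qed

lemma texp_trunc_eq: "texp_trunc emb N (\<lambda>k. t *\<^sub>R l k) = trunc N (texp l t)"
proof -
  have pow: "(tmul_trunc emb N (\<lambda>k. t *\<^sub>R l k) ^^ k) (tone emb) = trunc N (\<lambda>n. t ^ k *\<^sub>R tpower l k n)" for k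
  proof (induction k)
    case 0
    show ?case by (simp add: tpower_0 trunc_tone)
  next
    case (Suc k)
    have "tmul emb (\<lambda>k. t *\<^sub>R l k) (\<lambda>n. t ^ k *\<^sub>R tpower l k n) = (\<lambda>n. t ^ Suc k *\<^sub>R tpower l (Suc k) n)"
      by (simp add: tmul_def tpower_Suc fun_eq_iff tens_scaleR_left tens_scaleR_right tpow_scaleR
          tensor_seriesD[OF l] tpower_in_tpow scaleR_sum_right mult.commute)
    thus ?case by (simp add: Suc.IH tmul_trunc_trunc)
  qed
  show ?thesis
  proof
    fix n
    have "suminf (\<lambda>k. trunc N (\<lambda>n. t ^ k *\<^sub>R tpower l k n) n /\<^sub>R fact k)
        = (\<Sum>k\<le>n. trunc N (\<lambda>n. t ^ k *\<^sub>R tpower l k n) n /\<^sub>R fact k)"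
      by (rule suminf_finite) (auto simp: trunc_def tpower_eq_0_below)
    thus "texp_trunc emb N (\<lambda>k. t *\<^sub>R l k) n = trunc N (texp l t) n"
      by (simp add: texp_trunc_def pow) (simp add: trunc_def texp_def divide_inverse mult.commute)
  qed
qed

text \<open>The inverse of \<open>exp(sl)\<close> is \<open>exp(-sl)\<close>, and truncation is compatible with products.\<close>
lemma increments_texp: "increments emb N (\<lambda>t. texp_trunc emb N (\<lambda>k. t *\<^sub>R l k)) s t = trunc N (texp l (t - s))"
proof -
  have "tinv_trunc emb N (trunc N (texp l s)) = trunc N (texp l (- s))"
    by (rule tinv_trunc_eqI)
      (simp_all add: trunc_tensors_eq trunc_trunc trunc_in_series texp_in_series
        tmul_trunc_trunc, simp_all add: tmul_trunc_def[symmetric] tmul_trunc_trunc texp_add texp_zero trunc_tone)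
  thus ?thesis
    unfolding increments_def texp_trunc_eq
    by (simp add: tmul_trunc_trunc) (simp add: tmul_trunc_def[symmetric] tmul_trunc_trunc texp_add)
qed

lemma continuous_texp: "continuous_on A (\<lambda>(s, t). texp l (t - s) n)"
  unfolding texp_def case_prod_beta by (intro continuous_intros) auto

text \<open>
  Only powers \<open>l\<^sup>k\<close> with \<open>km \<ge> n\<close> reach degree \<open>n\<close>, and for them \<open>h\<^sup>k \<le> h\<^bsup>n/m\<^esup>\<close> when \<open>0 < h \<le> 1\<close>.
\<close>
lemma texp_holder:
  assumes m: "\<And>i. m < i \<Longrightarrow> l i = 0" "1 \<le> m" and n: "1 \<le> n"
  shows "\<exists>C\<ge>0. \<forall>s t. 0 \<le> s \<longrightarrow> s < t \<longrightarrow> t \<le> 1 \<longrightarrow>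
    norm (texp l (t - s) n) \<le> C * (t - s) powr (real n / real m)"
proof (intro exI conjI allI impI)
  define C where "C = (\<Sum>k\<le>n. norm (tpower l k n))"
  show "0 \<le> C" by (simp add: C_def sum_nonneg)
  fix s t :: real assume st: "0 \<le> s" "s < t" "t \<le> 1"
  define h where "h = t - s"
  have h: "0 < h" "h \<le> 1" using st by (auto simp: h_def)
  have "norm (texp l h n) \<le> (\<Sum>k\<le>n. norm (tpower l k n) * h powr (real n / real m))"
    unfolding texp_def
  proof (rule sum_norm_le)
    fix k
    show "norm ((h ^ k / fact k) *\<^sub>R tpower l k n) \<le> norm (tpower l k n) * h powr (real n / real m)"
    proof (cases "k * m < n")
      case True
      thus ?thesis using tpower_eq_0_above[OF m(1)] by simp
    next
      case False
      hence "real n \<le> real k * real m" by (metis not_less of_nat_le_iff of_nat_mult)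
      hence "real n / real m \<le> real k" using m(2) by (simp add: field_simps)
      hence "h powr real k \<le> h powr (real n / real m)"
        using h by (intro powr_mono') auto
      hence "h ^ k \<le> h powr (real n / real m)" using h by (simp add: powr_realpow)
      moreover have "h ^ k / fact k \<le> h ^ k / 1"
        using h by (intro divide_left_mono) (auto simp: fact_ge_1)
      ultimately have "h ^ k / fact k \<le> h powr (real n / real m)" by simp
      hence "h ^ k / fact k * norm (tpower l k n) \<le> h powr (real n / real m) * norm (tpower l k n)"
        by (intro mult_right_mono) auto
      thus ?thesis using h by (simp add: mult.commute)
    qed
  qed
  thus "norm (texp l (t - s) n) \<le> C * (t - s) powr (real n / real m)"
    by (simp add: C_def h_def sum_distrib_right)
qed

text \<open>
  The Cauchy estimate for the exponential: bounding one coefficient of \<open>l\<^sup>k\<close> by the weighted sum of all of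
  them gives \<open>P(r)\<^sup>k\<close>, and these add up to at most \<open>exp(P(r))\<close>.
\<close>
lemma norm_texp_weighted_le:
  assumes m: "\<And>i. m < i \<Longrightarrow> l i = 0" and r: "0 \<le> r"
  shows "norm (texp l 1 n) * r ^ n \<le> exp (\<Sum>i\<le>m. norm (l i) * r ^ i)"
proof -
  define P where "P = (\<Sum>i\<le>m. norm (l i) * r ^ i)"
  have "0 \<le> P" unfolding P_def using r by (intro sum_nonneg) auto
  have "norm (texp l 1 n) \<le> (\<Sum>k\<le>n. norm (tpower l k n) / fact k)"
    unfolding texp_def by (rule sum_norm_le) simp
  hence "norm (texp l 1 n) * r ^ n \<le> (\<Sum>k\<le>n. norm (tpower l k n) / fact k) * r ^ n"
    using r by (intro mult_right_mono) auto
  also have "\<dots> = (\<Sum>k\<le>n. (norm (tpower l k n) * r ^ n) / fact k)"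
    by (simp add: sum_distrib_right)
  also have "\<dots> \<le> (\<Sum>k\<le>n. P ^ k / fact k)"
  proof (intro sum_mono divide_right_mono)
    fix k
    have "norm (tpower l k n) * r ^ n \<le> (\<Sum>j\<le>n. norm (tpower l k j) * r ^ j)"
      using r by (intro member_le_sum) auto
    also have "\<dots> \<le> P ^ k"
      unfolding P_def using m r by (rule tpower_weighted_norm_le)
    finally show "norm (tpower l k n) * r ^ n \<le> P ^ k" .
  qed simp
  also have "\<dots> = (\<Sum>k\<le>n. P ^ k /\<^sub>R fact k)" by (simp add: field_simps)
  also have "\<dots> \<le> exp P"
    unfolding exp_def using \<open>0 \<le> P\<close> by (intro sum_le_suminf summable_exp_generic) auto
  finally show ?thesis by (simp add: P_def)
qed

end

end


section \<open>Uniqueness of the extension and the signature\<close>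

context tensor_algebra
begin

text \<open>
  Induction on the degree.  If two extensions agree below degree \<open>n > p\<close>, the mixed terms of their Chen
  relations coincide, so their difference in degree \<open>n\<close> is additive, that is, it consists of the increments of a
  continuous path.  This path has finite variation of exponent \<open>p/n < 1\<close> and is therefore constant.
\<close>
lemma lyons_extension_unique:
  assumes p: "1 \<le> p" and S: "lyons_extension emb p 1 X S" and S': "lyons_extension emb p 1 X S'"
  shows "0 \<le> s \<Longrightarrow> s \<le> t \<Longrightarrow> t \<le> 1 \<Longrightarrow> S s t n = S' s t n"
proof (induction n arbitrary: s t rule: less_induct)
  case (less n)
  have ext: "U s t \<in> tensor_series emb" "U s t 0 = tone emb 0" "trunc (nat \<lfloor>p\<rfloor>) (U s t) = X s t"
    if "lyons_extension emb p 1 X U" "0 \<le> s" "s \<le> t" "t \<le> 1" for U s t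
    using that by (auto simp: lyons_extension_def simplex2_def)
  show ?case
  proof (cases "n \<le> nat \<lfloor>p\<rfloor>")
    case True
    have "trunc (nat \<lfloor>p\<rfloor>) (S s t) n = trunc (nat \<lfloor>p\<rfloor>) (S' s t) n"
      using ext(3)[OF S] ext(3)[OF S'] less.prems by simp
    thus ?thesis using True by (simp add: trunc_def)
  next
    case False
    hence pn: "p < real n" using p by linarith
    hence n: "1 \<le> n" using p by linarith
    define D where "D s t = S s t n - S' s t n" for s t
    define q where "q = p / real n"
    have q: "0 < q" "q < 1" using p pn n by (auto simp: q_def)
    \<comment> \<open>Only the two extreme terms of the Chen relation contain degree \<open>n\<close>.\<close>
    have chen: "U s u n = U t u n + U s t n + (\<Sum>i\<in>{1..<n}. tens emb i (n - i) (U s t i) (U t u (n - i)))"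
      if U: "lyons_extension emb p 1 X U" and stu: "0 \<le> s" "s \<le> t" "t \<le> u" "u \<le> 1" for U s t u
    proof -
      have "U s u = tmul emb (U s t) (U t u)"
        using U stu unfolding lyons_extension_def by blast
      moreover have "{..n} = insert 0 (insert n {1..<n})" using n by auto
      ultimately have "U s u n = (\<Sum>i\<in>insert 0 (insert n {1..<n}). tens emb i (n - i) (U s t i) (U t u (n - i)))"
        by (simp only: tmul_def)
      also have "\<dots> = tens emb 0 n (U s t 0) (U t u n) + (tens emb n 0 (U s t n) (U t u 0)
          + (\<Sum>i\<in>{1..<n}. tens emb i (n - i) (U s t i) (U t u (n - i))))"
        using n by simp
      finally show ?thesis
        using ext[OF U, of s t] ext[OF U, of t u] stu
        by (simp add: tone_def tens_unit_left tens_unit_right tensor_seriesD)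
    qed
    have D_add: "D s u = D s t + D t u" if stu: "0 \<le> s" "s \<le> t" "t \<le> u" "u \<le> 1" for s t u
    proof -
      have "(\<Sum>i\<in>{1..<n}. tens emb i (n - i) (S s t i) (S t u (n - i)))
          = (\<Sum>i\<in>{1..<n}. tens emb i (n - i) (S' s t i) (S' t u (n - i)))"
        using stu by (intro sum.cong refl) (simp add: less.IH)
      thus ?thesis using chen[OF S stu] chen[OF S' stu] by (simp add: D_def)
    qed
    have D_zero: "D 0 0 = 0" using D_add[of 0 0 0] by simp
    have cont: "continuous_on {0..1} (\<lambda>t. U 0 t n)" if U: "lyons_extension emb p 1 X U" for U
    proof -
      have "continuous_on (simplex2 1) (\<lambda>(s, t). U s t n)"
        using U by (simp add: lyons_extension_def)
      hence "continuous_on {0..1} ((\<lambda>(s, t). U s t n) \<circ> (\<lambda>t. (0, t)))"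
        by (intro continuous_on_compose continuous_intros)
          (rule continuous_on_subset, auto simp: simplex2_def)
      thus ?thesis by (simp add: o_def)
    qed
    have var: "\<exists>K. \<forall>r t. (r, t) \<in> partitions_of 1 \<longrightarrow>
        (\<Sum>i<r. norm (U (t i) (t (Suc i)) n) powr q) \<le> K"
      if U: "lyons_extension emb p 1 X U" for U
    proof -
      have "total_pvar p 1 (max n (nat \<lfloor>p\<rfloor>)) U < \<infinity>"
        using U by (simp add: lyons_extension_def)
      from total_pvar_finiteD[OF _ this n] p show ?thesis
        unfolding q_def by simp
    qed
    obtain K where K: "\<And>r t. (r, t) \<in> partitions_of 1 \<Longrightarrow>
        (\<Sum>i<r. norm (S (t i) (t (Suc i)) n) powr q) \<le> K"
      using var[OF S] by blast
    obtain K' where K': "\<And>r t. (r, t) \<in> partitions_of 1 \<Longrightarrow>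
        (\<Sum>i<r. norm (S' (t i) (t (Suc i)) n) powr q) \<le> K'"
      using var[OF S'] by blast
    have path: "D 0 t = D 0 0" if t: "t \<in> {0..1}" for t
    proof (rule constant_if_finite_variation_below_one[OF _ q _ t])
      show "continuous_on {0..1} (D 0)"
        unfolding D_def by (intro continuous_intros cont S S')
      fix r :: nat assume r: "1 \<le> r"
      define u where "u i = real i / real r" for i
      have part: "(r, u) \<in> partitions_of 1"
        using r by (auto simp: partitions_of_def u_def divide_strict_right_mono)
      have "norm (D 0 (u (Suc i)) - D 0 (u i)) powr q
          \<le> norm (S (u i) (u (Suc i)) n) powr q + norm (S' (u i) (u (Suc i)) n) powr q"
        if i: "i < r" for i
      proof -
        have "D 0 (u (Suc i)) - D 0 (u i) = D (u i) (u (Suc i))"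
          using D_add[of 0 "u i" "u (Suc i)"] partition_interval[OF part i] by simp
        hence "norm (D 0 (u (Suc i)) - D 0 (u i)) powr q
            \<le> (norm (S (u i) (u (Suc i)) n) + norm (S' (u i) (u (Suc i)) n)) powr q"
          using q by (intro powr_mono2) (auto simp: D_def norm_triangle_ineq4)
        also have "\<dots> \<le> norm (S (u i) (u (Suc i)) n) powr q + norm (S' (u i) (u (Suc i)) n) powr q"
          using q by (intro powr_subadditive) auto
        finally show ?thesis .
      qed
      hence "(\<Sum>i<r. norm (D 0 (u (Suc i)) - D 0 (u i)) powr q)
          \<le> (\<Sum>i<r. norm (S (u i) (u (Suc i)) n) powr q) + (\<Sum>i<r. norm (S' (u i) (u (Suc i)) n) powr q)"
        unfolding sum.distrib[symmetric] by (intro sum_mono) auto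
      also have "\<dots> \<le> K + K'" by (intro add_mono K K' part)
      finally show "(\<Sum>i<r. norm (D 0 (real (Suc i) / real r) - D 0 (real i / real r)) powr q) \<le> K + K'"
        by (simp add: u_def)
    qed
    have "D s t = D 0 t - D 0 s" using D_add[of 0 s t] less.prems by simp
    also have "\<dots> = 0" using path[of s] path[of t] less.prems by (simp add: D_zero)
    finally show ?thesis by (simp add: D_def)
  qed
qed

context
  fixes l :: "nat \<Rightarrow> 'w" and m :: nat
  assumes m: "1 \<le> m" and l: "l \<in> trunc_tensors emb m" and l_0: "l 0 = 0"
begin

abbreviation exp_path :: "real \<Rightarrow> real \<Rightarrow> nat \<Rightarrow> 'w" where
  "exp_path \<equiv> increments emb m (\<lambda>t. texp_trunc emb m (\<lambda>k. t *\<^sub>R l k))"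

lemma l_series: "l \<in> tensor_series emb" and l_above: "m < i \<Longrightarrow> l i = 0"
  using l by (auto simp: trunc_tensors_def)

lemmas texp_props = texp_in_series[OF l_series l_0] texp_degree_0[OF l_series l_0]
  texp_add[OF l_series l_0] continuous_texp[OF l_series l_0]

lemma exp_path_eq: "exp_path s t = trunc m (texp l (t - s))"
  by (rule increments_texp[OF l_series l_0])

lemma total_pvar_texp: "total_pvar (real m) 1 N (\<lambda>s t. texp l (t - s)) < \<infinity>"
  using m texp_holder[OF l_series l_0 l_above m] by (intro total_pvar_finite) auto

lemma rough_path_exp_path: "rough_path emb (real m) 1 exp_path"
  unfolding rough_path_def exp_path_eq
proof (simp add: Let_def, intro conjI allI impI)
  show "\<forall>(s, t)\<in>simplex2 1. trunc m (texp l (t - s)) \<in> trunc_tensors emb m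
      \<and> trunc m (texp l (t - s)) 0 = tone emb 0"
    by (auto simp: trunc_tensors_eq trunc_trunc trunc_in_series texp_props)
      (simp add: trunc_def texp_props)
next
  fix k
  show "continuous_on (simplex2 1) (\<lambda>(s, t). trunc m (texp l (t - s)) k)"
    using texp_props(4)[of "simplex2 1" k] by (cases "k \<le> m") (simp_all add: trunc_def case_prod_beta)
next
  fix s t u :: real
  show "trunc m (texp l (u - s)) = tmul_trunc emb m (trunc m (texp l (t - s))) (trunc m (texp l (u - t)))"
    by (simp add: tmul_trunc_trunc) (simp add: tmul_trunc_def[symmetric] tmul_trunc_trunc texp_props)
next
  have "total_pvar (real m) 1 m (\<lambda>s t. trunc m (texp l (t - s)))
      = total_pvar (real m) 1 m (\<lambda>s t. texp l (t - s))"
    unfolding total_pvar_def by (intro sum.cong refl) (simp add: trunc_def)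
  thus "total_pvar (real m) 1 m (\<lambda>s t. trunc m (texp l (t - s))) < top"
    using total_pvar_texp[of m] by simp
qed

lemma lyons_extension_texp: "lyons_extension emb (real m) 1 exp_path (\<lambda>s t. texp l (t - s))"
  unfolding lyons_extension_def exp_path_eq
  using total_pvar_texp texp_props(4) by (auto simp: texp_props)

lemma signature_exp_path: "signature emb (real m) 1 exp_path = texp l 1"
  unfolding signature_def
proof (rule the_equality)
  show "\<exists>S. lyons_extension emb (real m) 1 exp_path S \<and> texp l 1 = S 0 1"
    using lyons_extension_texp by force
next
  fix g assume "\<exists>S. lyons_extension emb (real m) 1 exp_path S \<and> g = S 0 1"
  then obtain S where S: "lyons_extension emb (real m) 1 exp_path S" "g = S 0 1" by blast
  have "S 0 1 n = texp l (1 - 0) n" for n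
    using lyons_extension_unique[OF _ S(1) lyons_extension_texp, of 0 1 n] m by simp
  thus "g = texp l 1" using S by auto
qed

text \<open>
  The intermediate number \<open>A\<close> leaves room on both sides: \<open>A > \<parallel>l\<^sub>m\<parallel>\<close> absorbs the lower terms of the polynomial in
  the exponent, and \<open>A < B\<close> makes the integral against \<open>exp(-t)\<close> converge.
\<close>
lemma sig_limsup_exp_path: "sig_limsup emb (real m) 1 exp_path \<le> ereal (norm (l m))"
  unfolding sig_limsup_def signature_exp_path
proof (rule limsup_powr_le[OF m])
  fix n show "0 \<le> Gamma (real n / real m + 1) * norm (texp l 1 n)"
    by (intro mult_nonneg_nonneg less_imp_le[OF Gamma_real_pos]) (auto intro: add_nonneg_pos)
next
  fix B assume B: "norm (l m) < B"
  then obtain A where A: "norm (l m) < A" "A < B" using dense by blast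
  obtain C where C: "\<And>r. 0 \<le> r \<Longrightarrow> (\<Sum>i\<le>m. norm (l i) * r ^ i) \<le> C + A * r ^ m"
    using polynomial_le_top_term[of "\<lambda>i. norm (l i)" m A] A by auto
  have "norm (texp l 1 n) * r ^ n \<le> exp C * exp (A * r ^ m)" if "0 \<le> r" for n r
  proof -
    have "norm (texp l 1 n) * r ^ n \<le> exp (\<Sum>i\<le>m. norm (l i) * r ^ i)"
      by (rule norm_texp_weighted_le[OF l_series l_0 l_above that])
    also have "\<dots> \<le> exp (C + A * r ^ m)" using C that by simp
    finally show ?thesis by (simp add: exp_add)
  qed
  hence "Gamma (real n / real m + 1) * norm (texp l 1 n)
      \<le> exp C / (1 - A / B) * B powr (real n / real m)" for n
    using A m order.trans[OF norm_ge_zero less_imp_le[OF A(1)]]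
    by (intro Gamma_times_coefficient_le) auto
  thus "\<exists>K. \<forall>n. Gamma (real n / real m + 1) * norm (texp l 1 n) \<le> K * B powr (real n / real m)"
    by blast
qed simp

end

end

theorem theorem4p1:
  fixes scV :: "'f::real_normed_field \<Rightarrow> 'v::banach \<Rightarrow> 'v"
    and scW :: "'f \<Rightarrow> 'w::banach \<Rightarrow> 'w"
    and nrm :: "nat \<Rightarrow> ('v list \<Rightarrow>\<^sub>0 'f) \<Rightarrow> real"
    and emb :: "nat \<Rightarrow> ('v list \<Rightarrow>\<^sub>0 'f) \<Rightarrow> 'w"
    and m :: nat
    and l :: "nat \<Rightarrow> 'w"
    and X :: "real \<Rightarrow> real \<Rightarrow> nat \<Rightarrow> 'w"
  assumes "banach_over scV"
    and "banach_over scW"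
    and "reasonable_tensor_norms scV nrm"
    and "tensor_completion nrm scW emb"
    and "m \<ge> 1"
    and "l \<in> trunc_tensors emb m"
    and "l 0 = 0"
    and "X = increments emb m (\<lambda>t. texp_trunc emb m (\<lambda>k. t *\<^sub>R l k))"
  shows "rough_path emb (real m) 1 X \<and> sig_limsup emb (real m) 1 X \<le> ereal (norm (l m))"
proof -
  interpret tensor_algebra scV scW nrm emb
    using assms(2-4) by (rule tensor_algebra.intro)
  show ?thesis
    unfolding assms(8) using assms(5-7) by (intro conjI rough_path_exp_path sig_limsup_exp_path)
qed

end
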